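(* Let $X$ be a complete, finite rank median space. Then every component of the Roller boundary $\partial X$, equipped with the restriction of the extended metric $d$ of $\overline X$, is a complete median space of rank strictly lower than $\mathrm{rank}(X)$.
   Context: A metric space $(X,d)$ is a median space if for all $x,y,z\in X$ there is a unique point $m(x,y,z)$ lying in $I(x,y)\cap I(y,z)\cap I(z,x)$, where $I(x,y)=\{z\in X\mid d(x,y)=d(x,z)+d(z,y)\}$. A subset $C\subseteq X$ is convex if $I(x,y)\subseteq C$ for all $x,y\in C$. A halfspace is a nonempty convex subset $\mathfrak{h}\subseteq X$ whose complement $\mathfrak{h}^*=X\setminus\mathfrak{h}$ is also nonempty and convex; $\mathcal{H}$ is the set of halfspaces of $X$. The rank of a median space is the supremum of those $k\in\mathbb{N}$ such that the hypercube $\{-1,1\}^k$ (with coordinatewise majority as median) embeds in $(X,m)$ by an injective median-preserving map. Complete, finite rank median spaces are locally convex (every point has a basis of convex neighbourhoods) and have compact intervals. Roller compactification. Let $\mathcal{J}$ be the set of all intervals $I=I(x,y)$ of $X$ (singletons allowed); for $I=I(x,y)$ let $\pi_I\colon X\to I$, $\pi_I(z)=m(x,y,z)$. A nonempty intersection of two intervals is an interval. Put $$\overline X=\Big\{(x_I)_I\in\prod_{I\in\mathcal{J}}I\ \Big|\ \pi_{I\cap J}(x_I)=\pi_{I\cap J}(x_J)\ \ \forall I,J\in\mathcal{J},\ I\cap J\neq\emptyset\Big\},$$ and identify $X$ with its image under the injection $x\mapsto(\pi_I(x))_I$. The Roller boundary is $\partial X=\overline X\setminus X$. For $\xi=(x_I)_I\in\overline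 X$, let $\sigma_\xi\subseteq\mathcal{H}$ be the set of halfspaces $\mathfrak{h}$ such that $x_I\in\mathfrak{h}$ for some (equivalently, every) $I\in\mathcal{J}$ meeting both $\mathfrak{h}$ and $\mathfrak{h}^*$. Measure on halfspaces. For $x,y\in X$ put $\mathcal{H}(x|y)=\{\mathfrak{h}\in\mathcal{H}\mid x\notin\mathfrak{h},\ y\in\mathfrak{h}\}$ (a halfspace-interval). Let $\mathcal{B}$ be the $\sigma$-algebra on $\mathcal{H}$ generated by halfspace-intervals and $\nu$ the measure on $\mathcal{B}$ with $\nu(\mathcal{H}(x|y))=d(x,y)$ obtained by Carath\'eodory's extension from the ring of finite disjoint unions of halfspace-intervals (so $\nu(E)=\inf\sum_n d(x_n,y_n)$ over countable covers of $E$ by sets $\mathcal{H}(x_n|y_n)$, and $+\infty$ if there is none); let $\mathcal{B}_0$ be its completion. A subset $E\subseteq\mathcal{H}$ is morally measurable if $E\cap\mathcal{H}(x|y)\in\mathcal{B}_0$ for all $x,y\in X$; for such $E$, $\widehat\nu(E)=\sup\sum_i\nu(E\cap\mathcal{H}(x_i|y_i))$ over all families of pairwise disjoint halfspace-intervals $\mathcal{H}(x_i|y_i)$. Each $\sigma_\xi$ is morally measurable. Extended metric and components. For $\xi,\eta\in\overline X$ put $d(\xi,\eta)=\tfrac12\widehat\nu(\sigma_\xi\triangle\sigma_\eta)\in[0,+\infty]$; this is an extended metric extending the metric of $X$. A component of $\overline X$ is an equivalence class of the relation $d(\xi,\eta)<+\infty$. The subset $X$ is a single component; the components of $\partial X$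 are all the others. *)

theory Defs
  imports "HOL-Analysis.Analysis"
begin

section \<open>Median spaces\<close>

text \<open>
  A metric space is a carrier \<open>X\<close> with a distance function \<open>d\<close>, as in the locale
  \<^locale>\<open>Metric_space\<close>. All notions below depend only on the restriction of \<open>d\<close> to \<open>X\<close>.
\<close>

definition interval :: "'a set \<Rightarrow> ('a \<Rightarrow> 'a \<Rightarrow> real) \<Rightarrow> 'a \<Rightarrow> 'a \<Rightarrow> 'a set" where
  "interval X d x y = {z \<in> X. d x y = d x z + d z y}"

locale median_space = Metric_space X d for X :: "'a set" and d :: "'a \<Rightarrow> 'a \<Rightarrow> real" +
  assumes ex1_median:
    "\<And>x y z. \<lbrakk>x \<in> X; y \<in> X; z \<in> X\<rbrakk> \<Longrightarrow>
       \<exists>!p. p \<in> interval X d x y \<inter> interval X d y z \<inter> interval X d z x"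

definition median :: "'a set \<Rightarrow> ('a \<Rightarrow> 'a \<Rightarrow> real) \<Rightarrow> 'a \<Rightarrow> 'a \<Rightarrow> 'a \<Rightarrow> 'a" where
  "median X d x y z = (THE p. p \<in> interval X d x y \<inter> interval X d y z \<inter> interval X d z x)"

definition convex_in :: "'a set \<Rightarrow> ('a \<Rightarrow> 'a \<Rightarrow> real) \<Rightarrow> 'a set \<Rightarrow> bool" where
  "convex_in X d C \<longleftrightarrow> C \<subseteq> X \<and> (\<forall>x\<in>C. \<forall>y\<in>C. interval X d x y \<subseteq> C)"

definition halfspaces :: "'a set \<Rightarrow> ('a \<Rightarrow> 'a \<Rightarrow> real) \<Rightarrow> 'a set set" where
  "halfspaces X d =
     {h. h \<noteq> {} \<and> convex_in X d h \<and> X - h \<noteq> {} \<and> convex_in X d (X - h)}"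

definition hypercube :: "nat \<Rightarrow> (nat \<Rightarrow> int) set" where
  "hypercube k = ({..<k} \<rightarrow>\<^sub>E {-1, 1})"

text \<open>For three signs the majority is the sign of their sum.\<close>

definition majority :: "nat \<Rightarrow> (nat \<Rightarrow> int) \<Rightarrow> (nat \<Rightarrow> int) \<Rightarrow> (nat \<Rightarrow> int) \<Rightarrow> nat \<Rightarrow> int" where
  "majority k a b c = (\<lambda>i\<in>{..<k}. sgn (a i + b i + c i))"

definition hypercube_embeds :: "'a set \<Rightarrow> ('a \<Rightarrow> 'a \<Rightarrow> real) \<Rightarrow> nat \<Rightarrow> bool" where
  "hypercube_embeds X d k \<longleftrightarrow>
     (\<exists>f. f \<in> hypercube k \<rightarrow> X \<and> inj_on f (hypercube k) \<and>
        (\<forall>a\<in>hypercube k. \<forall>b\<in>hypercube k. \<forall>c\<in>hypercube k.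
           f (majority k a b c) = median X d (f a) (f b) (f c)))"

definition median_rank :: "'a set \<Rightarrow> ('a \<Rightarrow> 'a \<Rightarrow> real) \<Rightarrow> enat" where
  "median_rank X d = (SUP k\<in>{k. hypercube_embeds X d k}. enat k)"


section \<open>The Roller compactification\<close>

definition intervals :: "'a set \<Rightarrow> ('a \<Rightarrow> 'a \<Rightarrow> real) \<Rightarrow> 'a set set" where
  "intervals X d = {interval X d x y |x y. x \<in> X \<and> y \<in> X}"

text \<open>
  An interval may have several pairs of endpoints, but in a median space the value of
  \<open>m(x, y, z)\<close> is the same for every pair \<open>x\<close>, \<open>y\<close> with \<open>I = I(x, y)\<close>, so the description
  operator is well defined.
\<close>

definition interval_proj :: "'a set \<Rightarrow> ('a \<Rightarrow> 'a \<Rightarrow> real) \<Rightarrow> 'a set \<Rightarrow> 'a \<Rightarrow> 'a" where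
  "interval_proj X d I z =
     (THE p. \<exists>x\<in>X. \<exists>y\<in>X. I = interval X d x y \<and> p = median X d x y z)"

definition roller :: "'a set \<Rightarrow> ('a \<Rightarrow> 'a \<Rightarrow> real) \<Rightarrow> ('a set \<Rightarrow> 'a) set" where
  "roller X d =
     {\<xi> \<in> (\<Pi>\<^sub>E I\<in>intervals X d. I).
        \<forall>I\<in>intervals X d. \<forall>J\<in>intervals X d. I \<inter> J \<noteq> {} \<longrightarrow>
          interval_proj X d (I \<inter> J) (\<xi> I) = interval_proj X d (I \<inter> J) (\<xi> J)}"

definition roller_embed :: "'a set \<Rightarrow> ('a \<Rightarrow> 'a \<Rightarrow> real) \<Rightarrow> 'a \<Rightarrow> 'a set \<Rightarrow> 'a" where
  "roller_embed X d x = (\<lambda>I\<in>intervals X d. interval_proj X d I x)"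

definition ultrafilter_of ::
    "'a set \<Rightarrow> ('a \<Rightarrow> 'a \<Rightarrow> real) \<Rightarrow> ('a set \<Rightarrow> 'a) \<Rightarrow> 'a set set" where
  "ultrafilter_of X d \<xi> =
     {h \<in> halfspaces X d.
        \<exists>I\<in>intervals X d. I \<inter> h \<noteq> {} \<and> I \<inter> (X - h) \<noteq> {} \<and> \<xi> I \<in> h}"


section \<open>The measure on the set of halfspaces\<close>

definition halfspace_interval ::
    "'a set \<Rightarrow> ('a \<Rightarrow> 'a \<Rightarrow> real) \<Rightarrow> 'a \<Rightarrow> 'a \<Rightarrow> 'a set set" where
  "halfspace_interval X d x y = {h \<in> halfspaces X d. x \<notin> h \<and> y \<in> h}"

definition halfspace_intervals :: "'a set \<Rightarrow> ('a \<Rightarrow> 'a \<Rightarrow> real) \<Rightarrow> 'a set set set" where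
  "halfspace_intervals X d = {halfspace_interval X d x y |x y. x \<in> X \<and> y \<in> X}"

text \<open>
  Finite covers are included, since \<open>halfspace_interval X d x x = {}\<close> and \<open>d x x = 0\<close>. If there
  is no countable cover, the infimum is over the empty set, hence \<open>top\<close>.
\<close>

definition halfspace_outer ::
    "'a set \<Rightarrow> ('a \<Rightarrow> 'a \<Rightarrow> real) \<Rightarrow> 'a set set \<Rightarrow> ennreal" where
  "halfspace_outer X d E =
     (INF (x, y) \<in> {(x, y). range x \<subseteq> X \<and> range y \<subseteq> X \<and>
                            E \<subseteq> (\<Union>n::nat. halfspace_interval X d (x n) (y n))}.
        \<Sum>n. ennreal (d (x n) (y n)))"

text \<open>
  The completion of the Caratheodory extension restricted to the \<open>\<sigma>\<close>-algebra generated by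
  halfspace-intervals.
\<close>

definition halfspace_measure :: "'a set \<Rightarrow> ('a \<Rightarrow> 'a \<Rightarrow> real) \<Rightarrow> 'a set measure" where
  "halfspace_measure X d =
     completion (measure_of (halfspaces X d) (halfspace_intervals X d) (halfspace_outer X d))"

text \<open>
  Only meaningful for morally measurable \<open>E\<close>, that is, when \<open>E \<inter> A\<close> is measurable for every
  halfspace-interval \<open>A\<close>. Below it is applied to symmetric differences of ultrafilters of points
  of the Roller compactification, which are morally measurable in every median space. Indexed
  disjoint families are represented by sets of halfspace-intervals; a repeated member of such a
  family is empty and contributes nothing.
\<close>

definition moral_measure ::
    "'a set \<Rightarrow> ('a \<Rightarrow> 'a \<Rightarrow> real) \<Rightarrow> 'a set set \<Rightarrow> ennreal" where
  "moral_measure X d E =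
     (SUP \<A> \<in> {\<A>. \<A> \<subseteq> halfspace_intervals X d \<and> pairwise disjnt \<A>}.
        \<Sum>\<^sub>\<infinity>A\<in>\<A>. emeasure (halfspace_measure X d) (E \<inter> A))"


section \<open>The extended metric and the components of the Roller boundary\<close>

definition roller_dist ::
    "'a set \<Rightarrow> ('a \<Rightarrow> 'a \<Rightarrow> real) \<Rightarrow> ('a set \<Rightarrow> 'a) \<Rightarrow> ('a set \<Rightarrow> 'a) \<Rightarrow> ennreal" where
  "roller_dist X d \<xi> \<eta> =
     moral_measure X d (sym_diff (ultrafilter_of X d \<xi>) (ultrafilter_of X d \<eta>)) / 2"

definition roller_components ::
    "'a set \<Rightarrow> ('a \<Rightarrow> 'a \<Rightarrow> real) \<Rightarrow> ('a set \<Rightarrow> 'a) set set" where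
  "roller_components X d =
     roller X d // {(\<xi>, \<eta>). \<xi> \<in> roller X d \<and> \<eta> \<in> roller X d \<and> roller_dist X d \<xi> \<eta> < top}"

text \<open>The image of \<open>X\<close> is itself a component; the boundary components are all the others.\<close>

definition boundary_components ::
    "'a set \<Rightarrow> ('a \<Rightarrow> 'a \<Rightarrow> real) \<Rightarrow> ('a set \<Rightarrow> 'a) set set" where
  "boundary_components X d = roller_components X d - {roller_embed X d ` X}"

text \<open>
  Real-valued version of the extended metric, to be used on a single component, where all
  distances are finite.
\<close>

definition component_dist ::
    "'a set \<Rightarrow> ('a \<Rightarrow> 'a \<Rightarrow> real) \<Rightarrow> ('a set \<Rightarrow> 'a) \<Rightarrow> ('a set \<Rightarrow> 'a) \<Rightarrow> real" where
  "component_dist X d \<xi> \<eta> = enn2real (roller_dist X d \<xi> \<eta>)"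

end

theory Submission
  imports Defs
begin

text \<open>
  Two points are separated by a halfspace, so a point of \<open>X\<close> or of the Roller compactification is
  determined by the halfspaces containing it, and identities between medians become propositional
  tautologies. The coordinate of \<open>\<xi>\<close> in \<open>I(x, y)\<close> behaves like a median \<open>m(x, y, \<xi>)\<close>.

  Finite sets of halfspace-intervals all of which separate \<open>\<xi>\<close> from \<open>\<eta>\<close> lie in a single one of the
  form \<open>H(\<xi>\<^sub>I|\<eta>\<^sub>I)\<close>. Hence the extended metric is the supremum over all intervals \<open>I\<close> of
  \<open>d(\<xi>\<^sub>I, \<eta>\<^sub>I)\<close>, and coordinatewise medians and limits show that components are complete median
  spaces. If \<open>\<xi>\<close> has finite distance from \<open>X\<close>, points \<open>m(p, \<xi>\<^sub>I, \<xi>)\<close> of \<open>X\<close> converge to \<open>\<xi>\<close>, so that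
  boundary components are infinitely far from \<open>X\<close>.

  For the rank, the coordinates of a \<open>k\<close>-cube in a boundary component are given by halfspaces
  \<open>h\<^sub>1, \<dots>, h\<^sub>k\<close> of \<open>X\<close>, all of whose \<open>2^k\<close> orthants contain a point of \<open>X\<close>. Infinitely much measure
  separates one of these points from the component, and only finitely much of it separates these points
  from each other or the vertices of the cube from each other. A remaining halfspace is transverse to
  \<open>h\<^sub>1, \<dots>, h\<^sub>k\<close>, and \<open>k + 1\<close> halfspaces with nonempty orthants yield a \<open>(k + 1)\<close>-cube in \<open>X\<close>.
\<close>

section \<open>The geometry of median spaces\<close>

context median_space
begin

abbreviation iv :: "'a \<Rightarrow> 'a \<Rightarrow> 'a set" where "iv \<equiv> interval X d"
abbreviation med :: "'a \<Rightarrow> 'a \<Rightarrow> 'a \<Rightarrow> 'a" where "med \<equiv> median X d"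
abbreviation \<H> :: "'a set set" where "\<H> \<equiv> halfspaces X d"
abbreviation HI :: "'a \<Rightarrow> 'a \<Rightarrow> 'a set set" where "HI \<equiv> halfspace_interval X d"

section \<open>Betweenness, medians and projections to intervals\<close>

lemma iv_iff: "z \<in> iv x y \<longleftrightarrow> z \<in> X \<and> d x y = d x z + d z y"
  by (auto simp: interval_def)

lemma iv_sub: "iv x y \<subseteq> X"
  by (auto simp: interval_def)

lemma iv_commute: "iv x y = iv y x"
  by (auto simp: interval_def commute)

lemma iv_endpoints [simp]: "x \<in> X \<Longrightarrow> y \<in> X \<Longrightarrow> x \<in> iv x y" "x \<in> X \<Longrightarrow> y \<in> X \<Longrightarrow> y \<in> iv x y"
  by (auto simp: iv_iff)

lemma iv_same [simp]: "x \<in> X \<Longrightarrow> iv x x = {x}"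
  by (auto simp: iv_iff) (smt (verit) nonneg zero commute)

lemma iv_trans:
  assumes "a \<in> iv x y" "b \<in> iv x a" "x \<in> X" "y \<in> X"
  shows "b \<in> iv x y" "a \<in> iv b y"
  using assms triangle[of x b y] triangle[of b a y] by (auto simp: iv_iff)

lemma med_iv:
  assumes "x \<in> X" "y \<in> X" "z \<in> X"
  shows "med x y z \<in> X" "med x y z \<in> iv x y" "med x y z \<in> iv y z" "med x y z \<in> iv x z"
proof -
  have "med x y z \<in> iv x y \<inter> iv y z \<inter> iv z x"
    unfolding median_def using ex1_median[OF assms] by (rule theI')
  then show "med x y z \<in> X" "med x y z \<in> iv x y" "med x y z \<in> iv y z" "med x y z \<in> iv x z"
    by (auto simp: iv_commute iv_iff)
qed

lemma med_eqI:
  assumes "x \<in> X" "y \<in> X" "z \<in> X" "p \<in> iv x y" "p \<in> iv y z" "p \<in> iv x z"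
  shows "med x y z = p"
  unfolding median_def using ex1_median[OF assms(1-3)] assms(4-6) iv_commute
  by (intro the1_equality) auto

lemma med_absorb: "a \<in> iv x y \<Longrightarrow> x \<in> X \<Longrightarrow> y \<in> X \<Longrightarrow> med x y a = a"
  by (rule med_eqI) (auto simp: iv_iff)

text \<open>The medians \<open>q\<close> and \<open>r\<close> of \<open>z\<close>, \<open>u\<close>
  and an endpoint lie on a chain \<open>x, q, r, y\<close> with additive distances, so
  \<open>s = med z q r\<close> meets all three conditions that determine \<open>med x y z\<close>.
  As \<open>s\<close> lies between \<open>z\<close> and \<open>q\<close>, it lies between
  \<open>z\<close> and \<open>u\<close>. Thus \<open>med x y\<close> acts as the gate projection to
  \<open>iv x y\<close>.\<close>

lemma gate:
  assumes X: "x \<in> X" "y \<in> X" "z \<in> X" and u: "u \<in> iv x y"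
  shows "med x y z \<in> iv z u"
proof -
  have uX: "u \<in> X" using u by (simp add: iv_iff)
  define q r where "q = med z u x" and "r = med z u y"
  have q: "q \<in> X" "q \<in> iv z u" "q \<in> iv u x" "q \<in> iv z x"
    and r: "r \<in> X" "r \<in> iv z u" "r \<in> iv u y" "r \<in> iv z y"
    unfolding q_def r_def using med_iv X uX by auto
  have qr: "d x y = d x q + d q r + d r y"
    using u q r triangle[of q r y] triangle[of q u r] triangle[of x q r] triangle[of x r y] X uX
    by (auto simp: iv_iff commute)
  define s where "s = med z q r"
  have s: "s \<in> X" "s \<in> iv z q" "s \<in> iv q r" "s \<in> iv z r"
    unfolding s_def using med_iv X q r by auto
  have "s \<in> iv z x" "s \<in> iv z y"
    using iv_trans(1) s q r X by blast+
  moreover have "s \<in> iv x y"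
    using qr s triangle[of x s y] triangle[of x q s] triangle[of s r y] X q r
    by (auto simp: iv_iff)
  ultimately have "med x y z = s"
    using X by (intro med_eqI) (auto simp: iv_commute)
  moreover have "s \<in> iv z u"
    using iv_trans(1) s q uX X by blast
  ultimately show ?thesis by simp
qed

text \<open>The gate \<open>?p\<close> of \<open>w\<close> lies between \<open>w\<close> and each of
  \<open>u\<close>, \<open>v\<close>. As \<open>w\<close> lies between \<open>u\<close> and
  \<open>v\<close>, passing through \<open>?p\<close> instead of \<open>w\<close> would shorten the
  way from \<open>u\<close> to \<open>v\<close> by twice \<open>d w ?p\<close>, which must be
  zero.\<close>

lemma iv_convex:
  assumes X: "x \<in> X" "y \<in> X" and u: "u \<in> iv x y" and v: "v \<in> iv x y" and w: "w \<in> iv u v"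
  shows "w \<in> iv x y"
proof -
  have wX: "w \<in> X" "u \<in> X" "v \<in> X" using u v w by (auto simp: iv_iff)
  let ?p = "med x y w"
  have p: "?p \<in> X" "?p \<in> iv x y" using med_iv X wX by auto
  have "?p \<in> iv w u" "?p \<in> iv w v" using gate X wX u v by auto
  then have "d w ?p = 0"
    using w triangle[of u ?p v] wX p nonneg[of w ?p] by (auto simp: iv_iff commute)
  then show ?thesis using p wX by auto
qed

lemma iv_mono:
  assumes "x \<in> X" "y \<in> X" "u \<in> iv x y" "v \<in> iv x y"
  shows "iv u v \<subseteq> iv x y"
  using iv_convex assms by blast

lemma med_lipschitz:
  assumes X: "x \<in> X" "y \<in> X" "z \<in> X" "w \<in> X"
  shows "d (med x y z) (med x y w) \<le> d z w"
proof -
  let ?p = "med x y z" and ?q = "med x y w"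
  have p: "?p \<in> X" "?p \<in> iv x y" "?q \<in> X" "?q \<in> iv x y" using med_iv X by auto
  have "?p \<in> iv z ?q" "?q \<in> iv w ?p" using gate X p by auto
  then show ?thesis
    using triangle[of z w ?q] triangle[of w z ?p] p X by (auto simp: iv_iff commute)
qed

text \<open>With \<open>g\<close> the gate of \<open>p\<close> in \<open>iv a b\<close>, the claim
  is \<open>p = g\<close>. Projecting \<open>p\<close> and \<open>g\<close> back to
  \<open>iv u v\<close> gives \<open>z'\<close> and \<open>w\<close>. Computing
  \<open>d u p + d v p\<close> through \<open>g\<close> and through \<open>z'\<close> yields
  \<open>d z' p = d w g + d g p\<close>, whence \<open>z' = w\<close>, and then
  \<open>d z' g = d z' p + d p g\<close> leaves no room for \<open>d p g\<close>.\<close>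

lemma gate_preserves_betweenness:
  assumes X: "x \<in> X" "y \<in> X" "u \<in> X" "v \<in> X" and z: "z \<in> iv u v"
  shows "med x y z \<in> iv (med x y u) (med x y v)"
proof -
  have zX: "z \<in> X" using z by (simp add: iv_iff)
  define p a b g where "p = med x y z" and "a = med x y u" and "b = med x y v" and "g = med a b p"
  have abp: "p \<in> X" "a \<in> X" "b \<in> X" "p \<in> iv x y" "a \<in> iv x y" "b \<in> iv x y"
    unfolding p_def a_def b_def using med_iv X zX by auto
  have g: "g \<in> X" "g \<in> iv a b" unfolding g_def using med_iv abp by auto
  have gxy: "g \<in> iv x y" using iv_mono X abp g by blast
  have ga: "g \<in> iv p a" "g \<in> iv p b" unfolding g_def using gate[of a b p] abp by auto
  have "a \<in> iv u p" "b \<in> iv v p" "p \<in> iv z g" 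
    unfolding p_def a_def b_def using gate X zX gxy abp[unfolded p_def] by auto
  then have gu: "g \<in> iv u p" "g \<in> iv v p"
    using ga iv_trans(1)[of a p u g] iv_trans(1)[of b p v g] X abp by (auto simp: iv_commute)
  define w z' where "w = med u v g" and "z' = med u v p"
  have w: "w \<in> X" "w \<in> iv u v" "w \<in> iv u g" "w \<in> iv v g"
    and z': "z' \<in> X" "z' \<in> iv u v" "z' \<in> iv u p" "z' \<in> iv v p"
    unfolding w_def z'_def using med_iv X g abp by auto
  have "z' \<in> iv p z" "z' \<in> iv p w"
    unfolding z'_def using gate[of u v p] X abp z w by auto
  then have pz': "p \<in> iv z' g"
    using \<open>p \<in> iv z g\<close> \<open>z' \<in> iv p z\<close> iv_trans(2)[of p z g z'] zX g iv_commute[of p z] by simp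
  have gw: "g \<in> iv w p" 
    using gu(1) w(3) iv_trans(2)[of g u p w] X abp by blast
  have e1: "d w p = d p z' + d z' w" using \<open>z' \<in> iv p w\<close> by (auto simp: iv_iff commute)
  have e2: "d w p = d w g + d g p" using gw by (auto simp: iv_iff)
  have e3: "d z' g = d z' p + d p g" using pz' by (auto simp: iv_iff)
  have e4: "d z' w \<le> d p g" unfolding z'_def w_def using med_lipschitz X abp g by blast
  have e5: "d u p = d u g + d g p" "d v p = d v g + d g p" using gu by (auto simp: iv_iff)
  have e6: "d u g = d u w + d w g" "d v g = d v w + d w g" using w by (auto simp: iv_iff)
  have e7: "d u p = d u z' + d z' p" "d v p = d v z' + d z' p" using z' by (auto simp: iv_iff)
  have e8: "d u v = d u z' + d v z'" "d u v = d u w + d v w" using z' w by (auto simp: iv_iff commute)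
  have e9: "d z' g \<le> d z' w + d w g" using triangle z' w g by auto
  have "d p g = 0"
    using e1 e2 e3 e4 e5 e6 e7 e8 e9 commute[of p z'] commute[of p g] nonneg[of p g] by linarith
  then have "p = g" using abp g by auto
  then show ?thesis using g p_def a_def b_def by auto
qed

section \<open>Separation of points by halfspaces\<close>

lemma convex_join_point:
  assumes K: "convex_in X d K" and uX: "u \<in> X"
  shows "convex_in X d (\<Union>c\<in>K. iv c u)"
  unfolding convex_in_def
proof (intro conjI ballI subsetI)
  fix z assume "z \<in> (\<Union>c\<in>K. iv c u)" then show "z \<in> X" by (auto simp: iv_iff)
next
  fix z z' t assume "z \<in> (\<Union>c\<in>K. iv c u)" "z' \<in> (\<Union>c\<in>K. iv c u)" and t: "t \<in> iv z z'"
  then obtain c c' where c: "c \<in> K" "c' \<in> K" "z \<in> iv c u" "z' \<in> iv c' u" by auto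
  have X: "c \<in> X" "c' \<in> X" "z \<in> X" "z' \<in> X" "t \<in> X"
    using c t K by (auto simp: iv_iff convex_in_def)
  define e where "e = med c c' t"
  have e: "e \<in> X" "e \<in> iv c c'" "e \<in> iv t c" "e \<in> iv t c'"
    unfolding e_def using med_iv[of c c' t] X iv_commute[of t c] iv_commute[of t c'] by auto
  have eK: "e \<in> K" using e c K by (auto simp: convex_in_def)
  \<comment> \<open>Projection to \<open>iv t s\<close> sends \<open>c\<close>, \<open>c'\<close>
    and \<open>u\<close> to \<open>s\<close>, hence also \<open>z\<close> and \<open>z'\<close>, and
    hence the point \<open>t\<close> between them. But it fixes \<open>t\<close>, so
    \<open>t = s\<close>, which lies between \<open>e\<close> and \<open>u\<close>.\<close>
  define s where "s = med t u e"
  have s: "s \<in> X" "s \<in> iv t u" "s \<in> iv t e" "s \<in> iv e u"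
    unfolding s_def using med_iv[of t u e] X e uX iv_commute[of e u] by auto
  have st: "s \<in> iv t c" "s \<in> iv t c'" using iv_trans(1) s e X by blast+
  have pr: "med t s q = s" if "q \<in> X" "s \<in> iv t q" for q
    using that X s by (intro med_eqI) auto
  have "med t s z \<in> iv (med t s c) (med t s u)" "med t s z' \<in> iv (med t s c') (med t s u)"
    using gate_preserves_betweenness X s uX c by auto
  then have "med t s z = s" "med t s z' = s"
    using pr X st s uX by auto
  moreover have "med t s t \<in> iv (med t s z) (med t s z')"
    using gate_preserves_betweenness X s t by auto
  moreover have "med t s t = t" using X s by (intro med_eqI) auto
  ultimately have "t = s" using s by auto
  then show "t \<in> (\<Union>c\<in>K. iv c u)" using s eK by auto
qed

text \<open>A maximal convex set containing \<open>y\<close> but not \<open>x\<close> has a convex complement.\<close>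

lemma halfspace_separates:
  assumes X: "x \<in> X" "y \<in> X" and "x \<noteq> y"
  obtains h where "h \<in> \<H>" "x \<notin> h" "y \<in> h"
proof -
  let ?A = "{K. convex_in X d K \<and> y \<in> K \<and> x \<notin> K}"
  have "\<exists>M\<in>?A. \<forall>K\<in>?A. M \<subseteq> K \<longrightarrow> K = M"
  proof (rule subset_Zorn_nonempty)
    have "convex_in X d {y}" using X by (auto simp: convex_in_def)
    then show "?A \<noteq> {}" using \<open>x \<noteq> y\<close> by blast
  next
    fix \<C> assume ne: "\<C> \<noteq> {}" and ch: "subset.chain ?A \<C>"
    have "convex_in X d (\<Union>\<C>)"
      unfolding convex_in_def
    proof (intro conjI ballI)
      show "\<Union>\<C> \<subseteq> X" using ch by (auto simp: subset.chain_def convex_in_def)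
      fix u v assume "u \<in> \<Union>\<C>" "v \<in> \<Union>\<C>"
      then obtain K where "K \<in> \<C>" "u \<in> K" "v \<in> K"
        using ch by (auto simp: subset.chain_def) blast
      moreover have "convex_in X d K" if "K \<in> \<C>" for K
        using ch that by (auto simp: subset.chain_def)
      then have "iv u v \<subseteq> K" using \<open>K \<in> \<C>\<close> \<open>u \<in> K\<close> \<open>v \<in> K\<close> by (simp add: convex_in_def)
      ultimately show "iv u v \<subseteq> \<Union>\<C>" by blast
    qed
    then show "\<Union>\<C> \<in> ?A" using ne ch by (auto simp: subset.chain_def)
  qed
  then obtain h where h: "convex_in X d h" "y \<in> h" "x \<notin> h"
    and mx: "\<And>K. convex_in X d K \<Longrightarrow> x \<notin> K \<Longrightarrow> h \<subseteq> K \<Longrightarrow> K = h"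
    by (smt (verit) mem_Collect_eq subset_iff)
  have hX: "h \<subseteq> X" using h by (simp add: convex_in_def)
  \<comment> \<open>By maximality: joining \<open>u\<close> to \<open>h\<close> gives a larger
    convex set, which therefore contains \<open>x\<close>.\<close>
  have ext: "\<exists>c\<in>h. x \<in> iv c u" if u: "u \<in> X - h" for u
  proof (rule ccontr)
    assume "\<not> ?thesis"
    then have "(\<Union>c\<in>h. iv c u) = h"
      using hX u convex_join_point[OF h(1)] by (intro mx) (auto intro: iv_endpoints)
    moreover have "u \<in> iv y u" using u X by auto
    ultimately show False using u h by auto
  qed
  have "convex_in X d (X - h)"
    unfolding convex_in_def
  proof (intro conjI ballI subsetI)
    fix u v w assume u: "u \<in> X - h" and v: "v \<in> X - h" and w: "w \<in> iv u v"
    have wX: "w \<in> X" using w by (simp add: iv_iff)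
    show "w \<in> X - h"
    proof (rule ccontr)
      assume "w \<notin> X - h"
      then have wh: "w \<in> h" using wX by auto
      obtain c c' where c: "c \<in> h" "x \<in> iv c u" "c' \<in> h" "x \<in> iv c' v"
        using ext u v by meson
      have cX: "c \<in> X" "c' \<in> X" "u \<in> X" "v \<in> X" using c hX u v by auto
      define e where "e = med x c c'"
      have e: "e \<in> X" "e \<in> iv c c'" "e \<in> iv x c" "e \<in> iv x c'"
        unfolding e_def using med_iv cX X by auto
      have eh: "e \<in> h" using e c h by (auto simp: convex_in_def)
      \<comment> \<open>Projection to \<open>iv x s\<close> sends \<open>c\<close>,
        \<open>c'\<close> and \<open>w\<close> to \<open>s\<close> and fixes \<open>x\<close>. As
        \<open>x\<close> lies between \<open>c\<close> and \<open>u\<close>, the image of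
        \<open>u\<close> must be \<open>x\<close>, and likewise that of \<open>v\<close>. So
        \<open>w\<close>, between \<open>u\<close> and \<open>v\<close>, goes to \<open>x\<close>,
        that is \<open>s = x\<close>; but \<open>s\<close> lies between the points \<open>w\<close>
        and \<open>e\<close> of \<open>h\<close>.\<close>
      define s where "s = med x w e"
      have s: "s \<in> X" "s \<in> iv x w" "s \<in> iv x e" "s \<in> iv w e"
        unfolding s_def using med_iv cX wX X e by auto
      have sc: "s \<in> iv x c" "s \<in> iv x c'" using iv_trans(1) s e X cX by blast+
      have pr: "med x s q = s" if "q \<in> X" "s \<in> iv x q" for q
        using that X s by (intro med_eqI) auto
      have px: "med x s x = x" using X s by (intro med_eqI) auto
      have key: "med x s q = x" if "q \<in> X" "x \<in> iv (med x s r) (med x s q)" "med x s r = s" for q r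
      proof -
        have "med x s q \<in> iv x s" using med_iv X s that by auto
        moreover have "x \<in> iv s (med x s q)" using that by auto
        ultimately have "d x (med x s q) = 0"
          by (auto simp: iv_iff commute)
        then show ?thesis using X med_iv(1)[of x s q] s that by auto
      qed
      have "med x s u = x"
        using gate_preserves_betweenness[of x s c u x] px c cX X s sc pr
        by (intro key[of u c]) simp_all
      moreover have "med x s v = x"
        using gate_preserves_betweenness[of x s c' v x] px c cX X s sc pr
        by (intro key[of v c']) simp_all
      moreover have "med x s w \<in> iv (med x s u) (med x s v)"
        using gate_preserves_betweenness X s cX w by auto
      ultimately have "s = x" using pr wX s X by auto
      then have "x \<in> h" using s wh eh h by (auto simp: convex_in_def)
      then show False using h by simp
    qed
  qed auto
  then have "h \<in> \<H>" using h X by (auto simp: halfspaces_def)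
  then show ?thesis using that h by auto
qed

section \<open>Medians and intervals read off from halfspaces\<close>

lemma halfspace_Compl: "h \<in> \<H> \<Longrightarrow> X - h \<in> \<H>"
  by (auto simp: halfspaces_def convex_in_def double_diff)

lemma halfspace_sub: "h \<in> \<H> \<Longrightarrow> h \<subseteq> X"
  by (auto simp: halfspaces_def convex_in_def)

lemma halfspace_iv_in: "h \<in> \<H> \<Longrightarrow> z \<in> iv x y \<Longrightarrow> x \<in> h \<Longrightarrow> y \<in> h \<Longrightarrow> z \<in> h"
  by (auto simp: halfspaces_def convex_in_def)

lemma halfspace_iv_out:
  assumes "h \<in> \<H>" "z \<in> iv x y" "x \<in> X" "y \<in> X" "z \<in> h" shows "x \<in> h \<or> y \<in> h"
proof (rule ccontr)
  assume "\<not> ?thesis"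
  then have "iv x y \<subseteq> X - h" using assms by (auto simp: halfspaces_def convex_in_def)
  then show False using assms by blast
qed

text \<open>Both sides of a halfspace are convex, so the median joins the side that holds two of the
  three points.\<close>

lemma med_in_halfspace:
  assumes "h \<in> \<H>" "x \<in> X" "y \<in> X" "z \<in> X"
  shows "med x y z \<in> h \<longleftrightarrow> (x \<in> h \<and> y \<in> h \<or> x \<in> h \<and> z \<in> h \<or> y \<in> h \<and> z \<in> h)"
  using med_iv[OF assms(2-4)] halfspace_iv_in[OF assms(1)] halfspace_iv_out[OF assms(1)] assms(2-4)
  by metis

lemma eq_by_halfspaces:
  assumes "x \<in> X" "y \<in> X" "\<And>h. h \<in> \<H> \<Longrightarrow> x \<in> h \<longleftrightarrow> y \<in> h"
  shows "x = y"
  using halfspace_separates assms by metis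

text \<open>Applied to complements, the hypothesis gives the opposite implication as well, so
  \<open>z\<close> and \<open>med x y z\<close> lie in the same halfspaces.\<close>

lemma iv_by_halfspaces:
  assumes X: "x \<in> X" "y \<in> X" "z \<in> X" and h: "\<And>h. h \<in> \<H> \<Longrightarrow> x \<in> h \<Longrightarrow> y \<in> h \<Longrightarrow> z \<in> h"
  shows "z \<in> iv x y"
proof -
  have "z = med x y z"
  proof (rule eq_by_halfspaces)
    fix k assume k: "k \<in> \<H>"
    have "x \<in> k \<or> y \<in> k" if "z \<in> k"
      using h[OF halfspace_Compl[OF k]] X that by auto
    then show "z \<in> k \<longleftrightarrow> med x y z \<in> k" using h[OF k] k med_in_halfspace X by auto
  qed (use X med_iv in auto)
  then show ?thesis using med_iv X by metis
qed

text \<open>The common point \<open>u\<close> links the intervals: a halfspace containing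
  \<open>c\<close> and \<open>e\<close> contains \<open>u\<close>, hence \<open>a\<close> or
  \<open>b\<close>, and so both projections. This turns the compatibility condition of
  \<open>roller\<close> into a statement about intervals with known endpoints.\<close>

lemma iv_Int_iv:
  assumes X: "a \<in> X" "b \<in> X" "c \<in> X" "e \<in> X" and u: "u \<in> iv a b" "u \<in> iv c e"
  shows "iv a b \<inter> iv c e = iv (med a b c) (med a b e)"
proof (intro set_eqI iffI IntI)
  have M: "med a b c \<in> X" "med a b e \<in> X" using med_iv X by auto
  fix w assume w: "w \<in> iv a b \<inter> iv c e"
  show "w \<in> iv (med a b c) (med a b e)"
  proof (rule iv_by_halfspaces)
    fix h assume h: "h \<in> \<H>" "med a b c \<in> h" "med a b e \<in> h"
    then show "w \<in> h"
      using w halfspace_iv_in[OF h(1), of w a b] halfspace_iv_in[OF h(1), of w c e]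
      by (auto simp: med_in_halfspace X)
  qed (use M w in \<open>auto simp: iv_iff\<close>)
next
  fix w assume w: "w \<in> iv (med a b c) (med a b e)"
  then show "w \<in> iv a b" using iv_mono[of a b] med_iv X by blast
  have M: "med a b c \<in> X" "med a b e \<in> X" using med_iv X by auto
  show "w \<in> iv c e"
  proof (rule iv_by_halfspaces)
    fix h assume h: "h \<in> \<H>" "c \<in> h" "e \<in> h"
    then have "u \<in> h" using u halfspace_iv_in by blast
    then have "a \<in> h \<or> b \<in> h" using halfspace_iv_out u X h by blast
    then have "med a b c \<in> h" "med a b e \<in> h" using h X by (auto simp: med_in_halfspace)
    then show "w \<in> h" using halfspace_iv_in h w by blast
  qed (use w X in \<open>auto simp: iv_iff\<close>)
qed

section \<open>Lengths of halfspace-intervals and finite subadditivity\<close>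

lemma HI_iff: "h \<in> HI x y \<longleftrightarrow> h \<in> \<H> \<and> x \<notin> h \<and> y \<in> h"
  by (auto simp: halfspace_interval_def)

text \<open>By passing to complements, a halfspace that separates \<open>a\<close> and
  \<open>b\<close> in either direction has \<open>c\<close> on the side of \<open>a\<close> and
  \<open>e\<close> on the side of \<open>b\<close>. So \<open>a\<close> and \<open>b\<close> are the
  projections of \<open>c\<close> and \<open>e\<close> to \<open>iv a b\<close>, and projections do
  not increase distances.\<close>

lemma dist_mono_HI:
  assumes X: "a \<in> X" "b \<in> X" "c \<in> X" "e \<in> X" and sub: "HI a b \<subseteq> HI c e"
  shows "d a b \<le> d c e"
proof -
  have *: "c \<notin> h \<and> e \<in> h" if "h \<in> \<H>" "a \<notin> h" "b \<in> h" for h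
    using that sub by (auto simp: HI_iff subset_iff)
  have **: "c \<in> h \<and> e \<notin> h" if "h \<in> \<H>" "a \<in> h" "b \<notin> h" for h
    using *[of "X - h"] that X halfspace_Compl by auto
  have "med a b c = a" 
  proof (rule eq_by_halfspaces)
    show "(med a b c \<in> h) = (a \<in> h)" if "h \<in> \<H>" for h
      using med_in_halfspace[OF that] X *[OF that] **[OF that] by auto
  qed (use X med_iv in auto)
  moreover have "med a b e = b" 
  proof (rule eq_by_halfspaces)
    show "(med a b e \<in> h) = (b \<in> h)" if "h \<in> \<H>" for h
      using med_in_halfspace[OF that] X *[OF that] **[OF that] by auto
  qed (use X med_iv in auto)
  ultimately show ?thesis using med_lipschitz[of a b c e] X by auto
qed

text \<open>Projecting \<open>a\<close> and then \<open>b\<close> gives points \<open>s\<close>,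
  \<open>t\<close> on a geodesic from \<open>x\<close> to \<open>y\<close>; within
  \<open>HI x y\<close>, the members of \<open>HI a b\<close> are those crossed between
  \<open>s\<close> and \<open>t\<close>. This is the semiring property behind the Caratheodory
  extension.\<close>

lemma HI_decompose:
  assumes X: "x \<in> X" "y \<in> X" "a \<in> X" "b \<in> X"
  obtains s t where "s \<in> X" "t \<in> X" "HI x y \<inter> HI a b = HI s t"
    "HI x y - HI a b = HI x s \<union> HI t y" "d x y = d x s + d s t + d t y"
    "s \<in> iv x t" "t \<in> iv s y"
proof -
  define s t where "s = med x y a" and "t = med s y b"
  have s: "s \<in> X" "s \<in> iv x y" unfolding s_def using X med_iv by auto
  have t: "t \<in> X" "t \<in> iv s y" unfolding t_def using X s med_iv by auto
  have d: "d x y = d x s + d s t + d t y" using s t by (auto simp: iv_iff)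
  have st: "s \<in> h \<longleftrightarrow> (x \<in> h \<and> y \<in> h \<or> x \<in> h \<and> a \<in> h \<or> y \<in> h \<and> a \<in> h)"
    "t \<in> h \<longleftrightarrow> (s \<in> h \<and> y \<in> h \<or> s \<in> h \<and> b \<in> h \<or> y \<in> h \<and> b \<in> h)" if "h \<in> \<H>" for h
    using med_in_halfspace that X s unfolding s_def t_def by auto
  have "HI x y \<inter> HI a b = HI s t" "HI x y - HI a b = HI x s \<union> HI t y"
    by (auto simp: HI_iff st)
  moreover have "s \<in> iv x t"
    using d triangle[of x t y] triangle[of x s t] X s t by (auto simp: iv_iff)
  ultimately show ?thesis using that s t d by blast
qed

text \<open>Cutting \<open>HI p q\<close> along one covering interval leaves the pieces
  \<open>HI p s\<close> and \<open>HI t q\<close>. Every other covering interval is replaced by its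
  traces on the pieces, and the induction hypothesis applies to each piece.\<close>

lemma finite_subadditive:
  assumes "finite F" "p \<in> X" "q \<in> X" "\<And>i. i \<in> F \<Longrightarrow> a i \<in> X \<and> b i \<in> X"
    and "HI p q \<subseteq> (\<Union>i\<in>F. HI (a i) (b i))"
  shows "d p q \<le> (\<Sum>i\<in>F. d (a i) (b i))"
  using assms
proof (induction F arbitrary: p q a b rule: finite_induct)
  case empty
  then have "p = q" using halfspace_separates[of p q] by (auto simp: HI_iff set_eq_iff)
  then show ?case using empty by auto
next
  case (insert n F)
  note X = insert.prems(1,2)
  have n: "a n \<in> X" "b n \<in> X" and F: "\<And>i. i \<in> F \<Longrightarrow> a i \<in> X \<and> b i \<in> X" using insert.prems by auto
  obtain s t where st: "s \<in> X" "t \<in> X" "HI p q \<inter> HI (a n) (b n) = HI s t"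
    "HI p q - HI (a n) (b n) = HI p s \<union> HI t q" "d p q = d p s + d s t + d t q"
    "s \<in> iv p t" "t \<in> iv s q"
    using HI_decompose[OF X n] by metis
  have dst: "d s t \<le> d (a n) (b n)"
    using dist_mono_HI[of s t "a n" "b n"] st n by auto
  define P where "P i a1 b1 a2 b2 \<longleftrightarrow> a1 \<in> X \<and> b1 \<in> X \<and> a2 \<in> X \<and> b2 \<in> X \<and>
     HI (a i) (b i) \<inter> HI p s = HI a1 b1 \<and> HI (a i) (b i) \<inter> HI t q = HI a2 b2 \<and>
     d a1 b1 + d a2 b2 \<le> d (a i) (b i)" for i a1 b1 a2 b2
  have "\<exists>a1 b1 a2 b2. P i a1 b1 a2 b2" if i: "i \<in> F" for i
  proof -
    have ab: "a i \<in> X" "b i \<in> X" using F i by auto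
    obtain a1 b1 where 1: "a1 \<in> X" "b1 \<in> X" "HI (a i) (b i) \<inter> HI p s = HI a1 b1"
      using HI_decompose[OF ab X(1) st(1)] by metis
    obtain a2 b2 where 2: "a2 \<in> X" "b2 \<in> X" "HI (a i) (b i) \<inter> HI t q = HI a2 b2"
      using HI_decompose[OF ab st(2) X(2)] by metis
    \<comment> \<open>The projection \<open>u\<close> of \<open>s\<close> splits
      \<open>iv (a i) (b i)\<close>: the trace on \<open>HI p s\<close> is crossed before
      \<open>u\<close>, the trace on \<open>HI t q\<close> after it, so their lengths add up to at
      most \<open>d (a i) (b i)\<close>.\<close>
    define u where "u = med (a i) (b i) s"
    have u: "u \<in> X" "u \<in> iv (a i) (b i)" unfolding u_def using med_iv ab st by auto
    have uh: "u \<in> h \<longleftrightarrow> (a i \<in> h \<and> b i \<in> h \<or> a i \<in> h \<and> s \<in> h \<or> b i \<in> h \<and> s \<in> h)" if "h \<in> \<H>" for h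
      using med_in_halfspace that ab st unfolding u_def by auto
    have "HI a1 b1 \<subseteq> HI (a i) u" unfolding 1(3)[symmetric] by (auto simp: HI_iff uh)
    then have "d a1 b1 \<le> d (a i) u" using dist_mono_HI 1 ab u by auto
    moreover have "HI a2 b2 \<subseteq> HI u (b i)"
      unfolding 2(3)[symmetric] using halfspace_iv_in[OF _ st(7)] by (auto simp: HI_iff uh)
    then have "d a2 b2 \<le> d u (b i)" using dist_mono_HI 2 ab u by auto
    ultimately have "d a1 b1 + d a2 b2 \<le> d (a i) (b i)" using u by (auto simp: iv_iff)
    then show ?thesis using 1 2 unfolding P_def by blast
  qed
  then obtain a1 b1 a2 b2 where "\<And>i. i \<in> F \<Longrightarrow> P i (a1 i) (b1 i) (a2 i) (b2 i)"
    by metis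
  then have r': "a1 i \<in> X \<and> b1 i \<in> X \<and> a2 i \<in> X \<and> b2 i \<in> X \<and>
     HI (a i) (b i) \<inter> HI p s = HI (a1 i) (b1 i) \<and> HI (a i) (b i) \<inter> HI t q = HI (a2 i) (b2 i) \<and>
     d (a1 i) (b1 i) + d (a2 i) (b2 i) \<le> d (a i) (b i)" if "i \<in> F" for i
    using that unfolding P_def by blast
  have sub: "HI p s \<union> HI t q \<subseteq> (\<Union>i\<in>F. HI (a i) (b i))"
    using insert.prems(4) st(4) by auto
  have "HI p s \<subseteq> (\<Union>i\<in>F. HI (a1 i) (b1 i))"
  proof
    fix h assume "h \<in> HI p s"
    then obtain i where "i \<in> F" "h \<in> HI (a i) (b i) \<inter> HI p s" using sub by auto
    then show "h \<in> (\<Union>i\<in>F. HI (a1 i) (b1 i))" using r' by auto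
  qed
  then have 1: "d p s \<le> (\<Sum>i\<in>F. d (a1 i) (b1 i))"
    using insert.IH[of p s a1 b1] X st r' by auto
  have "HI t q \<subseteq> (\<Union>i\<in>F. HI (a2 i) (b2 i))"
  proof
    fix h assume "h \<in> HI t q"
    then obtain i where "i \<in> F" "h \<in> HI (a i) (b i) \<inter> HI t q" using sub by auto
    then show "h \<in> (\<Union>i\<in>F. HI (a2 i) (b2 i))" using r' by auto
  qed
  then have 2: "d t q \<le> (\<Sum>i\<in>F. d (a2 i) (b2 i))"
    using insert.IH[of t q a2 b2] X st r' by auto
  have "(\<Sum>i\<in>F. d (a1 i) (b1 i)) + (\<Sum>i\<in>F. d (a2 i) (b2 i)) \<le> (\<Sum>i\<in>F. d (a i) (b i))"
    unfolding sum.distrib[symmetric] using r' by (intro sum_mono) auto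
  then show ?case using 1 2 dst st(5) insert.hyps by auto
qed

end


section \<open>The measure of a halfspace-interval\<close>

lemma compact_UNIV_bool_fun: "compact (UNIV :: ('a \<Rightarrow> bool) set)"
proof -
  have "compact_space (product_topology (\<lambda>i::'a. euclidean::bool topology) UNIV)"
    unfolding compact_space_product_topology
    by (auto simp: compact_space_def compactin_euclidean_iff finite_imp_compact)
  then show ?thesis by (simp add: euclidean_product_topology compact_space_def compactin_euclidean_iff)
qed

lemma clopen_coordinate:
  "open {\<phi> :: 'a \<Rightarrow> bool. \<phi> z}" "closed {\<phi> :: 'a \<Rightarrow> bool. \<phi> z}"
  "open {\<phi> :: 'a \<Rightarrow> bool. \<not> \<phi> z}" "closed {\<phi> :: 'a \<Rightarrow> bool. \<not> \<phi> z}"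
proof -
  have *: "{\<phi> :: 'a \<Rightarrow> bool. \<phi> z} = (\<lambda>\<phi>. \<phi> z) -` {True}" "{\<phi> :: 'a \<Rightarrow> bool. \<not> \<phi> z} = (\<lambda>\<phi>. \<phi> z) -` {False}"
    by auto
  show 1: "open {\<phi> :: 'a \<Rightarrow> bool. \<phi> z}" "open {\<phi> :: 'a \<Rightarrow> bool. \<not> \<phi> z}"
    unfolding * by (intro open_vimage open_discrete continuous_on_product_coordinates)+
  show "closed {\<phi> :: 'a \<Rightarrow> bool. \<phi> z}" "closed {\<phi> :: 'a \<Rightarrow> bool. \<not> \<phi> z}"
    using 1 by (auto simp: closed_def Collect_neg_eq[symmetric])
qed

context median_space
begin

abbreviation HO :: "'a set set \<Rightarrow> ennreal" where "HO \<equiv> halfspace_outer X d"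
abbreviation HM :: "'a set measure" where "HM \<equiv> halfspace_measure X d"

text \<open>The characteristic functions of \<open>HI p q\<close> form a closed set in the compact space of predicates.\<close>

lemma HI_countable_cover_finite:
  assumes X: "p \<in> X" "q \<in> X" "range a \<subseteq> X" "range b \<subseteq> X"
    and cover: "HI p q \<subseteq> (\<Union>n::nat. HI (a n) (b n))"
  obtains F :: "nat set" where "finite F" "HI p q \<subseteq> (\<Union>n\<in>F. HI (a n) (b n))"
proof -
  define T where "T = {(u, v, w). u \<in> X \<and> v \<in> X \<and> w \<in> iv u v}"
  \<comment> \<open>Convexity of a set and of its complement is a family of closed conditions, one
    pair for each triple in \<open>T\<close>. Values outside \<open>X\<close> are unconstrained, so
    predicates in \<open>K\<close> are cut down to \<open>X\<close> before they are used as
    halfspaces.\<close>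
  define K :: "('a \<Rightarrow> bool) set" where "K = {\<phi>. \<phi> q} \<inter> {\<phi>. \<not> \<phi> p} \<inter>
     (\<Inter>(u, v, w)\<in>T. {\<phi>. \<phi> u \<and> \<phi> v \<longrightarrow> \<phi> w} \<inter> {\<phi>. \<phi> w \<longrightarrow> \<phi> u \<or> \<phi> v})"
  define U :: "nat \<Rightarrow> ('a \<Rightarrow> bool) set" where "U n = {\<phi>. \<not> \<phi> (a n) \<and> \<phi> (b n)}" for n
  have "closed K"
    unfolding K_def
    by (intro closed_Int closed_INT ballI clopen_coordinate)
       (auto intro!: closed_Int closed_Collect_imp open_Collect_conj closed_Collect_disj clopen_coordinate)
  then have cK: "compact K"
    using compact_Int_closed[OF compact_UNIV_bool_fun, of K] by simp
  have K: "{z \<in> X. \<phi> z} \<in> HI p q" if "\<phi> \<in> K" for \<phi>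
  proof -
    have "\<phi> u \<and> \<phi> v \<longrightarrow> \<phi> w" "\<phi> w \<longrightarrow> \<phi> u \<or> \<phi> v" if "u \<in> X" "v \<in> X" "w \<in> iv u v" for u v w
      using \<open>\<phi> \<in> K\<close> that unfolding K_def T_def by auto
    then have "convex_in X d {z \<in> X. \<phi> z}" "convex_in X d (X - {z \<in> X. \<phi> z})"
      using iv_sub unfolding convex_in_def by blast+
    moreover have "\<phi> q" "\<not> \<phi> p" using \<open>\<phi> \<in> K\<close> unfolding K_def by auto
    ultimately show ?thesis using X unfolding HI_iff halfspaces_def by auto
  qed
  have "K \<subseteq> (\<Union>n. U n)"
  proof
    fix \<phi> assume "\<phi> \<in> K"
    then obtain n where "{z \<in> X. \<phi> z} \<in> HI (a n) (b n)" using K cover by blast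
    moreover have "a n \<in> X" "b n \<in> X" using X by auto
    ultimately show "\<phi> \<in> (\<Union>n. U n)" by (auto simp: HI_iff U_def)
  qed
  moreover have "open (U n)" for n
    unfolding U_def by (intro open_Collect_conj clopen_coordinate)
  ultimately obtain F where F: "finite F" "K \<subseteq> (\<Union>n\<in>F. U n)"
    using cK by (metis compactE_image)
  have "HI p q \<subseteq> (\<Union>n\<in>F. HI (a n) (b n))"
  proof
    fix h assume h: "h \<in> HI p q"
    then have hH: "h \<in> \<H>" by (simp add: HI_iff)
    then have "(\<lambda>z. z \<in> h) \<in> K"
      using h halfspace_iv_in[OF hH] halfspace_iv_out[OF hH] unfolding K_def T_def HI_iff by blast
    then show "h \<in> (\<Union>n\<in>F. HI (a n) (b n))" using F hH by (auto simp: U_def HI_iff)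
  qed
  then show ?thesis using that F by blast
qed

section \<open>The outer measure and its Caratheodory extension\<close>

lemma halfspace_outer_le:
  assumes "range x \<subseteq> X" "range y \<subseteq> X" "E \<subseteq> (\<Union>n. HI (x n) (y n))"
  shows "HO E \<le> (\<Sum>n. ennreal (d (x n) (y n)))"
  unfolding halfspace_outer_def using assms by (intro INF_lower2[of "(x, y)"]) auto

text \<open>By compactness a countable cover has a finite subcover, so finite subadditivity already
  gives the lower bound.\<close>

lemma halfspace_outer_HI:
  assumes X: "p \<in> X" "q \<in> X"
  shows "HO (HI p q) = ennreal (d p q)"
proof (rule antisym)
  \<comment> \<open>After the first, all members of this cover are \<open>HI p p\<close>, of length
    zero.\<close>
  let ?y = "\<lambda>n::nat. if n = 0 then q else p"
  have "HO (HI p q) \<le> (\<Sum>n. ennreal (d p (?y n)))"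
    using X by (intro halfspace_outer_le) auto
  also have "\<dots> = ennreal (d p q)"
    using X by (subst suminf_finite[of "{0}"]) auto
  finally show "HO (HI p q) \<le> ennreal (d p q)" .
next
  show "ennreal (d p q) \<le> HO (HI p q)"
    unfolding halfspace_outer_def
  proof (rule INF_greatest, clarsimp)
    fix a b :: "nat \<Rightarrow> 'a" assume ab: "range a \<subseteq> X" "range b \<subseteq> X"
      and cover: "HI p q \<subseteq> (\<Union>n. HI (a n) (b n))"
    obtain F :: "nat set" where F: "finite F" "HI p q \<subseteq> (\<Union>n\<in>F. HI (a n) (b n))"
      using HI_countable_cover_finite[OF X ab cover] .
    have "ennreal (d p q) \<le> ennreal (\<Sum>n\<in>F. d (a n) (b n))"
      using ab X F by (intro ennreal_leI finite_subadditive) auto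
    also have "\<dots> = (\<Sum>n\<in>F. ennreal (d (a n) (b n)))" by (simp add: sum_ennreal)
    also have "\<dots> \<le> (\<Sum>n. ennreal (d (a n) (b n)))" using F by (intro sum_le_suminf) auto
    finally show "ennreal (d p q) \<le> (\<Sum>n. ennreal (d (a n) (b n)))" .
  qed
qed

lemma halfspace_outer_close:
  assumes "HO E < e"
  obtains x y where "range x \<subseteq> X" "range y \<subseteq> X" "E \<subseteq> (\<Union>n. HI (x n) (y n))"
    "(\<Sum>n. ennreal (d (x n) (y n))) < e"
  using assms unfolding halfspace_outer_def INF_less_iff by auto

lemma outer_measure_space_halfspace_outer:
  assumes "X \<noteq> {}"
  shows "outer_measure_space (Pow \<H>) HO"
  unfolding outer_measure_space_def
proof (intro conjI)
  obtain x0 where x0: "x0 \<in> X" using assms by auto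
  have "HI x0 x0 = {}" by (auto simp: HI_iff)
  then show "positive (Pow \<H>) HO"
    using halfspace_outer_HI[OF x0 x0] x0 by (simp add: positive_def)
  show "increasing (Pow \<H>) HO"
    unfolding increasing_def halfspace_outer_def by (auto intro!: INF_superset_mono)
  show "countably_subadditive (Pow \<H>) HO"
    unfolding countably_subadditive_def
  proof (intro allI impI)
    fix A :: "nat \<Rightarrow> 'a set set"
    show "HO (\<Union>i. A i) \<le> (\<Sum>i. HO (A i))"
    proof (rule ennreal_le_epsilon)
      fix e :: real assume "0 < e" "(\<Sum>n. HO (A n)) < top"
      then have *: "\<And>n. HO (A n) < HO (A n) + e * (1/2)^Suc n"
        by (auto simp add: less_top dest!: ennreal_suminf_lessD)
      define Q where "Q n x y \<longleftrightarrow> range x \<subseteq> X \<and> range y \<subseteq> X \<and> A n \<subseteq> (\<Union>i. HI (x i) (y i)) \<and>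
          (\<Sum>i. ennreal (d (x i) (y i))) \<le> HO (A n) + e * (1/2)^Suc n" for n and x y :: "nat \<Rightarrow> 'a"
      have "\<exists>x y. Q n x y" for n
        unfolding Q_def by (rule halfspace_outer_close[OF *[of n]]) (blast intro: less_imp_le)
      then obtain x y where "\<And>n. Q n (x n) (y n)" by metis
      then have B: "\<And>n. range (x n) \<subseteq> X" "\<And>n. range (y n) \<subseteq> X"
        and sbB: "\<And>n. A n \<subseteq> (\<Union>i. HI (x n i) (y n i))"
        and Ble: "\<And>n. (\<Sum>i. ennreal (d (x n i) (y n i))) \<le> HO (A n) + e * (1/2)^(Suc n)"
        unfolding Q_def by blast+
      define f where "f = (\<lambda>(n, i). ennreal (d (x n i) (y n i)))"
      have "HO (\<Union>i. A i) \<le> (\<Sum>k. ennreal (d (case_prod x (prod_decode k)) (case_prod y (prod_decode k))))"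
      proof (rule halfspace_outer_le)
        show "range (\<lambda>k. case_prod x (prod_decode k)) \<subseteq> X"
          "range (\<lambda>k. case_prod y (prod_decode k)) \<subseteq> X"
          using B[THEN range_subsetD] by (auto simp: split_def)
        show "(\<Union>i. A i) \<subseteq> (\<Union>k. HI (case_prod x (prod_decode k)) (case_prod y (prod_decode k)))"
        proof
          fix h assume "h \<in> (\<Union>i. A i)"
          then obtain n i where "h \<in> HI (x n i) (y n i)" using sbB by blast
          then show "h \<in> (\<Union>k. HI (case_prod x (prod_decode k)) (case_prod y (prod_decode k)))"
            by (intro UN_I[of "prod_encode (n, i)"]) auto
        qed
      qed
      also have "\<dots> = (\<Sum>k. f (prod_decode k))"
        by (simp add: f_def split_def)
      also have "\<dots> = (\<Sum>n. \<Sum>i. ennreal (d (x n i) (y n i)))"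
        by (rule suminf_ennreal_2dimen) (simp add: f_def)
      also have "\<dots> \<le> (\<Sum>n. HO (A n) + e * (1/2) ^ Suc n)"
        by (intro suminf_le Ble) auto
      also have "\<dots> = (\<Sum>n. HO (A n)) + (\<Sum>n. ennreal e * ennreal ((1/2) ^ Suc n))"
        using \<open>0 < e\<close> by (subst suminf_add[symmetric])
                         (auto simp del: ennreal_suminf_cmult simp add: ennreal_mult[symmetric])
      also have "\<dots> = (\<Sum>n. HO (A n)) + e"
        unfolding ennreal_suminf_cmult
        by (subst suminf_ennreal_eq[OF zero_le_power power_half_series]) auto
      finally show "HO (\<Union>i. A i) \<le> (\<Sum>n. HO (A n)) + e" .
    qed
  qed
qed

lemma halfspace_outer_Un:
  assumes "X \<noteq> {}" "A \<subseteq> \<H>" "B \<subseteq> \<H>"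
  shows "HO (A \<union> B) \<le> HO A + HO B"
proof -
  have cs: "countably_subadditive (Pow \<H>) HO" and "HO {} = 0" and inc: "increasing (Pow \<H>) HO"
    using outer_measure_space_halfspace_outer[OF assms(1)]
    by (auto simp: outer_measure_space_def positive_def)
  \<comment> \<open>\<open>countably_subadditive\<close> concerns disjoint families, hence
    \<open>B - A\<close> in place of \<open>B\<close>.\<close>
  let ?D = "binaryset A (B - A)"
  have "range ?D \<subseteq> Pow \<H>" "disjoint_family ?D" "(\<Union>i. ?D i) \<in> Pow \<H>"
    using assms by (auto simp: disjoint_family_on_def binaryset_def split: if_splits)
  then have "HO (\<Union>i. ?D i) \<le> (\<Sum>i. HO (?D i))"
    using cs by (simp add: countably_subadditive_def)
  then have "HO (A \<union> B) \<le> HO A + HO (B - A)"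
    using suminf_binaryset_eq[of HO A "B - A"] \<open>HO {} = 0\<close> by (simp add: UN_binaryset_eq)
  also have "\<dots> \<le> HO A + HO B"
    using assms by (intro add_left_mono increasingD[OF inc]) auto
  finally show ?thesis .
qed

text \<open>Each interval of an almost optimal cover of \<open>E\<close> is cut into three by
  \<open>HI_decompose\<close>: the middle pieces cover \<open>E \<inter> HI a b\<close>, the outer
  ones cover the rest, and the lengths add up exactly.\<close>

lemma halfspace_interval_in_lambda_system:
  assumes ne: "X \<noteq> {}" and ab: "a \<in> X" "b \<in> X"
  shows "HI a b \<in> lambda_system \<H> (Pow \<H>) HO"
proof -
  interpret P: sigma_algebra \<H> "Pow \<H>" by (rule sigma_algebra_Pow)
  have sub: "HI x y \<subseteq> \<H>" for x y by (auto simp: HI_iff)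
  have "HO (E \<inter> HI a b) + HO (E - HI a b) \<le> HO E" if E: "E \<subseteq> \<H>" for E
  proof (rule ennreal_le_epsilon)
    fix e :: real assume "0 < e" "HO E < top"
    then have "HO E < HO E + e" by (auto simp: less_top)
    then obtain x y where xy: "range x \<subseteq> X" "range y \<subseteq> X" "E \<subseteq> (\<Union>n. HI (x n) (y n))"
      and le: "(\<Sum>n. ennreal (d (x n) (y n))) < HO E + e"
      using halfspace_outer_close by metis
    define Q where "Q n s t \<longleftrightarrow> s \<in> X \<and> t \<in> X \<and> HI (x n) (y n) \<inter> HI a b = HI s t \<and>
      HI (x n) (y n) - HI a b = HI (x n) s \<union> HI t (y n) \<and>
      d (x n) (y n) = d (x n) s + d s t + d t (y n)" for n s t
    have "\<exists>s t. Q n s t" for n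
    proof -
      have "x n \<in> X" "y n \<in> X" using xy by auto
      from this ab show ?thesis unfolding Q_def by (rule HI_decompose) blast
    qed
    then obtain s t where "\<And>n. Q n (s n) (t n)" by metis
    then have st: "\<And>n. s n \<in> X" "\<And>n. t n \<in> X"
      "\<And>n. HI (x n) (y n) \<inter> HI a b = HI (s n) (t n)"
      "\<And>n. HI (x n) (y n) - HI a b = HI (x n) (s n) \<union> HI (t n) (y n)"
      "\<And>n. d (x n) (y n) = d (x n) (s n) + d (s n) (t n) + d (t n) (y n)"
      unfolding Q_def by simp_all
    have "E \<inter> HI a b \<subseteq> (\<Union>n. HI (s n) (t n))"
      unfolding st(3)[symmetric] using xy(3) by auto
    then have 1: "HO (E \<inter> HI a b) \<le> (\<Sum>n. ennreal (d (s n) (t n)))"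
      using st by (intro halfspace_outer_le) auto
    have "E - HI a b \<subseteq> (\<Union>n. HI (x n) (s n)) \<union> (\<Union>n. HI (t n) (y n))"
      unfolding UN_Un_distrib[symmetric] st(4)[symmetric] using xy(3) by auto
    moreover have "increasing (Pow \<H>) HO"
      using outer_measure_space_halfspace_outer[OF ne] by (simp add: outer_measure_space_def)
    ultimately have "HO (E - HI a b) \<le> HO ((\<Union>n. HI (x n) (s n)) \<union> (\<Union>n. HI (t n) (y n)))"
      using E sub[THEN subsetD] by (intro increasingD[of "Pow \<H>" HO]) auto
    also have "\<dots> \<le> HO (\<Union>n. HI (x n) (s n)) + HO (\<Union>n. HI (t n) (y n))"
      using sub by (intro halfspace_outer_Un ne) auto
    also have "\<dots> \<le> (\<Sum>n. ennreal (d (x n) (s n))) + (\<Sum>n. ennreal (d (t n) (y n)))"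
      using xy st by (intro add_mono halfspace_outer_le) auto
    finally have "HO (E \<inter> HI a b) + HO (E - HI a b) \<le> (\<Sum>n. ennreal (d (s n) (t n))) +
        ((\<Sum>n. ennreal (d (x n) (s n))) + (\<Sum>n. ennreal (d (t n) (y n))))"
      using 1 by (rule add_mono[rotated])
    also have "\<dots> = (\<Sum>n. ennreal (d (x n) (y n)))"
      by (simp add: suminf_add ennreal_plus[symmetric] st(5) add_ac del: ennreal_plus)
    also have "\<dots> \<le> HO E + e" using le by simp
    finally show "HO (E \<inter> HI a b) + HO (E - HI a b) \<le> HO E + e" .
  qed
  moreover have "HO E \<le> HO (E \<inter> HI a b) + HO (E - HI a b)" if "E \<subseteq> \<H>" for E
    using halfspace_outer_Un[OF ne, of "E \<inter> HI a b" "E - HI a b"] that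
    by (metis Diff_subset Int_Diff_Un inf_le1 order_trans)
  ultimately show ?thesis
    unfolding P.lambda_system_eq using sub by (auto intro!: antisym)
qed

text \<open>\<open>measure_of\<close> returns the null measure unless the given function is a
  measure on the generated sigma-algebra. The Caratheodory lemma provides this on the larger
  \<open>lambda_system\<close>, from which it is restricted.\<close>

lemma halfspace_measure_HI:
  assumes "a \<in> X" "b \<in> X"
  shows "HI a b \<in> sets HM" "emeasure HM (HI a b) = ennreal (d a b)"
proof -
  have ne: "X \<noteq> {}" using assms by auto
  interpret P: sigma_algebra \<H> "Pow \<H>" by (rule sigma_algebra_Pow)
  let ?L = "lambda_system \<H> (Pow \<H>) HO" and ?G = "halfspace_intervals X d"
  have L: "measure_space \<H> ?L HO"
    by (rule P.caratheodory_lemma[OF outer_measure_space_halfspace_outer[OF ne]])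
  have G: "?G \<subseteq> ?L"
    using halfspace_interval_in_lambda_system[OF ne] by (auto simp: halfspace_intervals_def)
  have Pow: "?G \<subseteq> Pow \<H>" by (auto simp: halfspace_intervals_def HI_iff)
  have "sigma_sets \<H> ?G \<subseteq> ?L"
    using L G by (intro sigma_algebra.sigma_sets_subset) (auto simp: measure_space_def)
  then have M: "measure_space \<H> (sigma_sets \<H> ?G) HO"
    using L Pow by (intro measure_down[OF L] sigma_algebra_sigma_sets)
  let ?M = "measure_of \<H> ?G HO"
  have ab: "HI a b \<in> ?G" using assms by (auto simp: halfspace_intervals_def)
  have s: "HI a b \<in> sets ?M" using ab Pow by auto
  then show "HI a b \<in> sets HM" unfolding halfspace_measure_def by (rule sets_completionI_sets)
  have "emeasure ?M (HI a b) = HO (HI a b)"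
    using M s Pow by (intro emeasure_measure_of[of ?M]) (auto simp: measure_space_def)
  then show "emeasure HM (HI a b) = ennreal (d a b)"
    using s assms by (simp add: halfspace_measure_def halfspace_outer_HI sets_completionI_sets)
qed

end


section \<open>The Roller compactification\<close>

context median_space
begin

abbreviation \<R> :: "('a set \<Rightarrow> 'a) set" where "\<R> \<equiv> roller X d"
abbreviation uf :: "('a set \<Rightarrow> 'a) \<Rightarrow> 'a set set" where "uf \<equiv> ultrafilter_of X d"
abbreviation emb :: "'a \<Rightarrow> 'a set \<Rightarrow> 'a" where "emb \<equiv> roller_embed X d"

section \<open>Projections to intervals and compatible families\<close>

lemma iv_in_intervals [simp]: "x \<in> X \<Longrightarrow> y \<in> X \<Longrightarrow> iv x y \<in> intervals X d"
  by (auto simp: intervals_def)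

lemma intervalsE:
  assumes "I \<in> intervals X d" obtains x y where "x \<in> X" "y \<in> X" "I = iv x y"
  using assms by (auto simp: intervals_def)

text \<open>Two descriptions of one interval give gates \<open>?p\<close> and \<open>?q\<close> of
  \<open>z\<close>, each lying between \<open>z\<close> and the other, so they coincide. This
  justifies the description operator in \<open>interval_proj\<close>.\<close>

lemma med_endpoint_independent:
  assumes X: "x \<in> X" "y \<in> X" "x' \<in> X" "y' \<in> X" "z \<in> X" and eq: "iv x y = iv x' y'"
  shows "med x y z = med x' y' z"
proof -
  let ?p = "med x y z" and ?q = "med x' y' z"
  have pq: "?p \<in> X" "?q \<in> X" "?p \<in> iv x y" "?q \<in> iv x y" using med_iv X eq by auto
  have "?p \<in> iv z ?q" "?q \<in> iv z ?p" using gate X pq eq by auto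
  then have "d ?p ?q = 0" by (auto simp: iv_iff commute)
  then show ?thesis using pq by simp
qed

lemma interval_proj_iv:
  assumes "x \<in> X" "y \<in> X" "z \<in> X"
  shows "interval_proj X d (iv x y) z = med x y z"
  unfolding interval_proj_def
proof (rule the_equality)
  show "\<exists>x'\<in>X. \<exists>y'\<in>X. iv x y = iv x' y' \<and> med x y z = med x' y' z" using assms by blast
  fix p assume "\<exists>x'\<in>X. \<exists>y'\<in>X. iv x y = iv x' y' \<and> p = med x' y' z"
  then show "p = med x y z" using med_endpoint_independent assms by metis
qed

lemma roller_PiE: "\<xi> \<in> \<R> \<Longrightarrow> \<xi> \<in> (\<Pi>\<^sub>E I\<in>intervals X d. I)"
  unfolding roller_def by blast

lemma roller_ev:
  assumes "\<xi> \<in> \<R>" "x \<in> X" "y \<in> X"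
  shows "\<xi> (iv x y) \<in> iv x y" "\<xi> (iv x y) \<in> X"
proof -
  show "\<xi> (iv x y) \<in> iv x y"
    using roller_PiE[OF assms(1)] assms(2,3) by (rule PiE_mem[OF _ iv_in_intervals])
  then show "\<xi> (iv x y) \<in> X" by (simp add: iv_iff)
qed

lemma roller_consistent:
  assumes xi: "\<xi> \<in> \<R>" and X: "a \<in> X" "b \<in> X" "c \<in> X" "e \<in> X" "g \<in> X" "k \<in> X"
    and eq: "iv a b \<inter> iv c e = iv g k"
  shows "med g k (\<xi> (iv a b)) = med g k (\<xi> (iv c e))"
proof -
  have "iv a b \<inter> iv c e \<noteq> {}" using eq X iv_endpoints by blast
  moreover have "\<forall>I\<in>intervals X d. \<forall>J\<in>intervals X d. I \<inter> J \<noteq> {} \<longrightarrow>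
      interval_proj X d (I \<inter> J) (\<xi> I) = interval_proj X d (I \<inter> J) (\<xi> J)"
    using xi unfolding roller_def by blast
  ultimately have "interval_proj X d (iv g k) (\<xi> (iv a b)) = interval_proj X d (iv g k) (\<xi> (iv c e))"
    using X iv_in_intervals unfolding eq[symmetric] by blast
  then show ?thesis using interval_proj_iv roller_ev xi X by auto
qed

lemma rollerI:
  assumes ext: "\<xi> \<in> extensional (intervals X d)"
    and ev: "\<And>x y. x \<in> X \<Longrightarrow> y \<in> X \<Longrightarrow> \<xi> (iv x y) \<in> iv x y"
    and con: "\<And>a b c e g k. \<lbrakk>a \<in> X; b \<in> X; c \<in> X; e \<in> X; g \<in> X; k \<in> X; iv a b \<inter> iv c e = iv g k\<rbrakk>
      \<Longrightarrow> med g k (\<xi> (iv a b)) = med g k (\<xi> (iv c e))"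
  shows "\<xi> \<in> \<R>"
  unfolding roller_def
proof (intro CollectI conjI ballI impI)
  show "\<xi> \<in> (\<Pi>\<^sub>E I\<in>intervals X d. I)"
    unfolding PiE_def Pi_def
  proof (intro CollectI IntI allI impI ext)
    fix I assume "I \<in> intervals X d"
    then show "\<xi> I \<in> I" by (rule intervalsE) (simp add: ev)
  qed
next
  fix I J assume I: "I \<in> intervals X d" and J: "J \<in> intervals X d" and ne: "I \<inter> J \<noteq> {}"
  obtain a b where ab: "a \<in> X" "b \<in> X" "I = iv a b" using I by (rule intervalsE)
  obtain c e where ce: "c \<in> X" "e \<in> X" "J = iv c e" using J by (rule intervalsE)
  obtain u where "u \<in> iv a b" "u \<in> iv c e" using ne ab ce by auto
  then have "iv a b \<inter> iv c e = iv (med a b c) (med a b e)" using iv_Int_iv ab ce by blast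
  moreover have "med a b c \<in> X" "med a b e \<in> X" using ab ce med_iv by auto
  moreover have "\<xi> I \<in> X" "\<xi> J \<in> X" using ev ab ce iv_sub by blast+
  ultimately show "interval_proj X d (I \<inter> J) (\<xi> I) = interval_proj X d (I \<inter> J) (\<xi> J)"
    using interval_proj_iv con ab ce by simp
qed

text \<open>The two intervals meet in \<open>iv x g\<close>. Projection to \<open>iv x g\<close>
  preserves membership in \<open>h\<close>, because its endpoints lie on different sides, and the
  projections of the two coordinates agree.\<close>

lemma roller_shared_endpoint:
  assumes xi: "\<xi> \<in> \<R>" and h: "h \<in> \<H>" and X: "x \<in> X" "y \<in> X" "w \<in> X"
    and xh: "x \<notin> h" "y \<in> h" "w \<in> h"
  shows "\<xi> (iv x y) \<in> h \<longleftrightarrow> \<xi> (iv x w) \<in> h"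
proof -
  define g where "g = med x y w"
  have g: "g \<in> X" "g \<in> h" using med_iv med_in_halfspace X xh h by (auto simp: g_def)
  have "med x y x = x" using X by (intro med_eqI) auto
  then have eq: "iv x y \<inter> iv x w = iv x g"
    using iv_Int_iv[of x y x w x] X g_def by auto
  have "med x g (\<xi> (iv x y)) = med x g (\<xi> (iv x w))"
    using roller_consistent[OF xi _ _ _ _ _ _ eq] X g by auto
  moreover have "med x g z \<in> h \<longleftrightarrow> z \<in> h" if "z \<in> X" for z
    using med_in_halfspace that X g xh h by auto
  ultimately show ?thesis using roller_ev xi X by metis
qed

lemma roller_shared_endpoint_Compl:
  assumes xi: "\<xi> \<in> \<R>" and h: "h \<in> \<H>" and X: "x \<in> X" "y \<in> X" "w \<in> X"
    and xh: "x \<in> h" "y \<notin> h" "w \<notin> h"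
  shows "\<xi> (iv x y) \<in> h \<longleftrightarrow> \<xi> (iv x w) \<in> h"
  using roller_shared_endpoint[OF xi halfspace_Compl[OF h] X] roller_ev[OF xi] X xh by auto

text \<open>One endpoint is exchanged at a time, with \<open>iv x w\<close> as intermediate
  interval.\<close>

lemma roller_indep:
  assumes "\<xi> \<in> \<R>" "h \<in> \<H>" "x \<in> X" "y \<in> X" "z \<in> X" "w \<in> X"
    and "x \<notin> h" "y \<in> h" "z \<notin> h" "w \<in> h"
  shows "\<xi> (iv x y) \<in> h \<longleftrightarrow> \<xi> (iv z w) \<in> h"
  using roller_shared_endpoint[of \<xi> h x y w] roller_shared_endpoint_Compl[of \<xi> h w x z] assms
  by (simp add: iv_commute)

section \<open>Ultrafilters and the majority rule for coordinates\<close>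

lemma uf_sub: "uf \<xi> \<subseteq> \<H>"
  by (auto simp: ultrafilter_of_def)

text \<open>An interval meets both sides of a halfspace exactly if its endpoints lie on different
  sides, so \<open>roller_indep\<close> turns the existential quantifier in
  \<open>ultrafilter_of\<close> into a test on any one such interval.\<close>

lemma uf_iff:
  assumes xi: "\<xi> \<in> \<R>" and h: "h \<in> \<H>" and X: "x \<in> X" "y \<in> X" and xh: "x \<notin> h" "y \<in> h"
  shows "h \<in> uf \<xi> \<longleftrightarrow> \<xi> (iv x y) \<in> h"
proof
  assume "\<xi> (iv x y) \<in> h"
  then show "h \<in> uf \<xi>"
    using h X xh iv_in_intervals[OF X] iv_endpoints[OF X] unfolding ultrafilter_of_def by blast
next
  assume "h \<in> uf \<xi>"
  then obtain a b where ab: "a \<in> X" "b \<in> X" "iv a b \<inter> h \<noteq> {}" "iv a b \<inter> (X - h) \<noteq> {}" "\<xi> (iv a b) \<in> h"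
    unfolding ultrafilter_of_def by (auto elim!: intervalsE)
  then have "a \<in> h \<and> b \<notin> h \<or> a \<notin> h \<and> b \<in> h"
    using halfspace_iv_in[OF h] halfspace_iv_out[OF h] by blast
  then show "\<xi> (iv x y) \<in> h"
    using roller_indep[OF xi h, of a b x y] roller_indep[OF xi h, of b a x y] ab X xh
    by (auto simp: iv_commute)
qed

text \<open>When \<open>x\<close> and \<open>y\<close> lie on one side of \<open>h\<close>,
  convexity decides; otherwise \<open>uf_iff\<close> does. Coordinates thus obey the same rule as
  medians, with the ultrafilter in place of a third point.\<close>

lemma ev_in_halfspace:
  assumes xi: "\<xi> \<in> \<R>" and h: "h \<in> \<H>" and X: "x \<in> X" "y \<in> X"
  shows "\<xi> (iv x y) \<in> h \<longleftrightarrow> (x \<in> h \<and> y \<in> h \<or> x \<in> h \<and> h \<in> uf \<xi> \<or> y \<in> h \<and> h \<in> uf \<xi>)"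
  using uf_iff[OF xi h X] uf_iff[OF xi h X(2,1), unfolded iv_commute[of y x]]
    halfspace_iv_in[OF h roller_ev(1)[OF xi X]] halfspace_iv_out[OF h roller_ev(1)[OF xi X] X]
  by argo

lemma halfspace_crossed:
  assumes "h \<in> \<H>" obtains x y where "x \<in> X" "y \<in> X" "x \<notin> h" "y \<in> h"
proof -
  have "h \<noteq> {}" "X - h \<noteq> {}" "h \<subseteq> X" using assms halfspace_sub by (auto simp: halfspaces_def)
  then show ?thesis using that by blast
qed

lemma uf_Compl:
  assumes xi: "\<xi> \<in> \<R>" and h: "h \<in> \<H>"
  shows "X - h \<in> uf \<xi> \<longleftrightarrow> h \<notin> uf \<xi>"
proof -
  obtain x y where xy: "x \<in> X" "y \<in> X" "x \<notin> h" "y \<in> h" using h by (rule halfspace_crossed)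
  show ?thesis
    using uf_iff[OF xi h xy] uf_iff[OF xi halfspace_Compl[OF h] xy(2,1)] xy roller_ev[OF xi xy(1,2)]
    by (auto simp: iv_commute)
qed

lemma ev_eqI:
  assumes "\<xi> \<in> \<R>" "x \<in> X" "y \<in> X" "p \<in> X"
    and "\<And>h. h \<in> \<H> \<Longrightarrow> p \<in> h \<longleftrightarrow> (x \<in> h \<and> y \<in> h \<or> x \<in> h \<and> h \<in> uf \<xi> \<or> y \<in> h \<and> h \<in> uf \<xi>)"
  shows "\<xi> (iv x y) = p"
  by (rule eq_by_halfspaces) (use assms roller_ev ev_in_halfspace in auto)

lemma roller_eqI:
  assumes xi: "\<xi> \<in> \<R>" "\<eta> \<in> \<R>" and h: "\<And>h. h \<in> \<H> \<Longrightarrow> h \<in> uf \<xi> \<longleftrightarrow> h \<in> uf \<eta>"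
  shows "\<xi> = \<eta>"
proof (rule PiE_ext)
  show "\<xi> \<in> (\<Pi>\<^sub>E I\<in>intervals X d. I)" "\<eta> \<in> (\<Pi>\<^sub>E I\<in>intervals X d. I)"
    using roller_PiE xi by blast+
  fix I assume "I \<in> intervals X d"
  then obtain x y where xy: "x \<in> X" "y \<in> X" "I = iv x y" by (rule intervalsE)
  then show "\<xi> I = \<eta> I"
    using ev_eqI[OF xi(1) xy(1,2) roller_ev(2)[OF xi(2) xy(1,2)]] ev_in_halfspace[OF xi(2)] h by simp
qed

section \<open>The embedding of the space\<close>

lemma emb_iv: "x \<in> X \<Longrightarrow> a \<in> X \<Longrightarrow> b \<in> X \<Longrightarrow> emb x (iv a b) = med a b x"
  by (simp add: roller_embed_def interval_proj_iv)

text \<open>Projections to nested intervals compose, so both sides of the compatibility condition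
  are the projection of \<open>x\<close> to the intersection.\<close>

lemma emb_in_roller:
  assumes x: "x \<in> X" shows "emb x \<in> \<R>"
proof (rule rollerI)
  fix a b c e g k assume X: "a \<in> X" "b \<in> X" "c \<in> X" "e \<in> X" "g \<in> X" "k \<in> X"
    and eq: "iv a b \<inter> iv c e = iv g k"
  have "g \<in> iv a b" "k \<in> iv a b" "g \<in> iv c e" "k \<in> iv c e" using eq X iv_endpoints by blast+
  then have *: "med g k (med a b x) = med g k x" "med g k (med c e x) = med g k x"
    using X x med_iv
    by (auto intro!: eq_by_halfspaces simp: med_in_halfspace
        dest: halfspace_iv_in halfspace_iv_out[OF _ _ X(1,2)] halfspace_iv_out[OF _ _ X(3,4)])
  show "med g k (emb x (iv a b)) = med g k (emb x (iv c e))"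
    using * X x emb_iv by simp
qed (use x emb_iv med_iv in \<open>auto simp: roller_embed_def\<close>)

lemma uf_emb:
  assumes "x \<in> X" "h \<in> \<H>" shows "h \<in> uf (emb x) \<longleftrightarrow> x \<in> h"
proof -
  obtain a b where ab: "a \<in> X" "b \<in> X" "a \<notin> h" "b \<in> h" using assms(2) by (rule halfspace_crossed)
  show ?thesis
    using uf_iff[OF emb_in_roller[OF assms(1)] assms(2) ab] ab assms emb_iv med_in_halfspace by auto
qed

section \<open>Coordinatewise medians\<close>

definition rmed :: "('a set \<Rightarrow> 'a) \<Rightarrow> ('a set \<Rightarrow> 'a) \<Rightarrow> ('a set \<Rightarrow> 'a) \<Rightarrow> 'a set \<Rightarrow> 'a" where
  "rmed \<xi> \<eta> \<zeta> = (\<lambda>I\<in>intervals X d. med (\<xi> I) (\<eta> I) (\<zeta> I))"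

text \<open>Projection to an interval commutes with medians, by the majority rule, so compatibility
  is inherited.\<close>

lemma rmed_in_roller:
  assumes R: "\<xi> \<in> \<R>" "\<eta> \<in> \<R>" "\<zeta> \<in> \<R>" shows "rmed \<xi> \<eta> \<zeta> \<in> \<R>"
proof (rule rollerI)
  show "rmed \<xi> \<eta> \<zeta> \<in> extensional (intervals X d)" by (simp add: rmed_def)
next
  fix x y assume X: "x \<in> X" "y \<in> X"
  have "med (\<xi> (iv x y)) (\<eta> (iv x y)) (\<zeta> (iv x y)) \<in> iv (\<xi> (iv x y)) (\<eta> (iv x y))"
    using med_iv roller_ev R X by auto
  then show "rmed \<xi> \<eta> \<zeta> (iv x y) \<in> iv x y"
    using iv_mono[OF X roller_ev(1)[OF R(1) X] roller_ev(1)[OF R(2) X]] X by (auto simp: rmed_def)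
next
  fix a b c e g k assume X: "a \<in> X" "b \<in> X" "c \<in> X" "e \<in> X" "g \<in> X" "k \<in> X"
    and eq: "iv a b \<inter> iv c e = iv g k"
  have *: "med g k (med p q r) = med (med g k p) (med g k q) (med g k r)"
    if "p \<in> X" "q \<in> X" "r \<in> X" for p q r
    using that X med_iv by (auto intro!: eq_by_halfspaces simp: med_in_halfspace)
  show "med g k (rmed \<xi> \<eta> \<zeta> (iv a b)) = med g k (rmed \<xi> \<eta> \<zeta> (iv c e))"
    using roller_consistent[OF R(1) X eq] roller_consistent[OF R(2) X eq] roller_consistent[OF R(3) X eq]
    by (simp add: rmed_def X * roller_ev R)
qed

lemma uf_rmed:
  assumes R: "\<xi> \<in> \<R>" "\<eta> \<in> \<R>" "\<zeta> \<in> \<R>" and h: "h \<in> \<H>"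
  shows "h \<in> uf (rmed \<xi> \<eta> \<zeta>) \<longleftrightarrow>
    (h \<in> uf \<xi> \<and> h \<in> uf \<eta> \<or> h \<in> uf \<xi> \<and> h \<in> uf \<zeta> \<or> h \<in> uf \<eta> \<and> h \<in> uf \<zeta>)"
proof -
  obtain x y where xy: "x \<in> X" "y \<in> X" "x \<notin> h" "y \<in> h" using h by (rule halfspace_crossed)
  have "rmed \<xi> \<eta> \<zeta> (iv x y) = med (\<xi> (iv x y)) (\<eta> (iv x y)) (\<zeta> (iv x y))"
    using xy by (simp add: rmed_def)
  then show ?thesis
    using uf_iff[OF rmed_in_roller[OF R] h xy] uf_iff[OF R(1) h xy] uf_iff[OF R(2) h xy]
      uf_iff[OF R(3) h xy] med_in_halfspace[OF h] roller_ev xy R by simp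
qed

section \<open>The extended metric as a supremum of coordinate distances\<close>

definition rho :: "('a set \<Rightarrow> 'a) \<Rightarrow> ('a set \<Rightarrow> 'a) \<Rightarrow> ennreal" where
  "rho \<xi> \<eta> = (SUP (x, y)\<in>X \<times> X. ennreal (d (\<xi> (iv x y)) (\<eta> (iv x y))))"

text \<open>The analogue of \<open>HI\<close> for points of the compactification. It is one half of
  the symmetric difference of the ultrafilters; complements exchange it with the other half.\<close>

definition ufdiff :: "('a set \<Rightarrow> 'a) \<Rightarrow> ('a set \<Rightarrow> 'a) \<Rightarrow> 'a set set" where
  "ufdiff \<xi> \<eta> = {h \<in> \<H>. h \<notin> uf \<xi> \<and> h \<in> uf \<eta>}"

lemma rho_upper: "x \<in> X \<Longrightarrow> y \<in> X \<Longrightarrow> ennreal (d (\<xi> (iv x y)) (\<eta> (iv x y))) \<le> rho \<xi> \<eta>"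
  unfolding rho_def by (intro SUP_upper2[of "(x, y)"]) auto

lemma rho_least:
  "(\<And>x y. x \<in> X \<Longrightarrow> y \<in> X \<Longrightarrow> ennreal (d (\<xi> (iv x y)) (\<eta> (iv x y))) \<le> B) \<Longrightarrow> rho \<xi> \<eta> \<le> B"
  unfolding rho_def by (rule SUP_least) auto

lemma rho_commute: "rho \<xi> \<eta> = rho \<eta> \<xi>"
  by (simp add: rho_def commute)

lemma HI_ev_sub_ufdiff:
  assumes "\<xi> \<in> \<R>" "\<eta> \<in> \<R>" "p \<in> X" "q \<in> X"
  shows "HI (\<xi> (iv p q)) (\<eta> (iv p q)) \<subseteq> ufdiff \<xi> \<eta>"
  using assms by (auto simp: HI_iff ufdiff_def ev_in_halfspace)

text \<open>On \<open>HI x y\<close> the coordinate of a point in \<open>iv x y\<close> decides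
  membership in its ultrafilter, so the trace is an intersection of two halfspace-intervals. The
  measurability of all traces considered later rests on this.\<close>

lemma HI_Int_ufdiff:
  assumes R: "\<xi> \<in> \<R>" "\<eta> \<in> \<R>" and X: "x \<in> X" "y \<in> X"
  obtains s t where "s \<in> X" "t \<in> X" "ufdiff \<xi> \<eta> \<inter> HI x y = HI s t"
proof -
  have "ufdiff \<xi> \<eta> \<inter> HI x y = HI x y \<inter> HI (\<xi> (iv x y)) (\<eta> (iv x y))"
    using assms by (auto simp: HI_iff ufdiff_def ev_in_halfspace)
  then show ?thesis
    using HI_decompose[OF X roller_ev(2)[OF R(1) X] roller_ev(2)[OF R(2) X]] that by metis
qed

text \<open>The witnesses are the medians \<open>m(a, c, \<xi>)\<close> and
  \<open>m(b, e, \<eta>)\<close>, written as coordinates. A halfspace in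
  \<open>ufdiff \<xi> \<eta>\<close> that misses \<open>a\<close> or \<open>c\<close> misses the
  first, and one that contains \<open>b\<close> or \<open>e\<close> contains the second; it then
  separates the coordinates of \<open>\<xi>\<close> and \<open>\<eta>\<close> in the interval
  between them.\<close>

lemma ufdiff_directed:
  assumes R: "\<xi> \<in> \<R>" "\<eta> \<in> \<R>" and X: "a \<in> X" "b \<in> X" "c \<in> X" "e \<in> X"
    and sub: "HI a b \<subseteq> ufdiff \<xi> \<eta>" "HI c e \<subseteq> ufdiff \<xi> \<eta>"
  obtains p q where "p \<in> X" "q \<in> X" "HI a b \<union> HI c e \<subseteq> HI (\<xi> (iv p q)) (\<eta> (iv p q))"
proof
  show pq: "\<xi> (iv a c) \<in> X" "\<eta> (iv b e) \<in> X" using roller_ev R X by auto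
  show "HI a b \<union> HI c e \<subseteq> HI (\<xi> (iv (\<xi> (iv a c)) (\<eta> (iv b e)))) (\<eta> (iv (\<xi> (iv a c)) (\<eta> (iv b e))))"
  proof
    fix h assume h: "h \<in> HI a b \<union> HI c e"
    then have hH: "h \<in> \<H>" "h \<notin> uf \<xi>" "h \<in> uf \<eta>" using sub by (auto simp: HI_iff ufdiff_def)
    have "a \<notin> h \<or> c \<notin> h" "b \<in> h \<or> e \<in> h" using h by (auto simp: HI_iff)
    then have "\<xi> (iv a c) \<notin> h" "\<eta> (iv b e) \<in> h"
      using ev_in_halfspace[OF R(1) hH(1) X(1,3)] ev_in_halfspace[OF R(2) hH(1) X(2,4)] hH by auto
    then show "h \<in> HI (\<xi> (iv (\<xi> (iv a c)) (\<eta> (iv b e)))) (\<eta> (iv (\<xi> (iv a c)) (\<eta> (iv b e))))"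
      using ev_in_halfspace[OF R(1) hH(1) pq] ev_in_halfspace[OF R(2) hH(1) pq] hH unfolding HI_iff by auto
  qed
qed

lemma ufdiff_directed_finite:
  assumes R: "\<xi> \<in> \<R>" "\<eta> \<in> \<R>" and "finite F" "X \<noteq> {}"
    and "\<And>i. i \<in> F \<Longrightarrow> a i \<in> X \<and> b i \<in> X \<and> HI (a i) (b i) \<subseteq> ufdiff \<xi> \<eta>"
  shows "\<exists>p\<in>X. \<exists>q\<in>X. (\<Union>i\<in>F. HI (a i) (b i)) \<subseteq> HI (\<xi> (iv p q)) (\<eta> (iv p q))"
  using assms(3-)
proof (induction F rule: finite_induct)
  case empty
  then show ?case by auto
next
  case (insert n F)
  then obtain p q where pq: "p \<in> X" "q \<in> X"
    "(\<Union>i\<in>F. HI (a i) (b i)) \<subseteq> HI (\<xi> (iv p q)) (\<eta> (iv p q))" by auto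
  have n: "a n \<in> X" "b n \<in> X" "HI (a n) (b n) \<subseteq> ufdiff \<xi> \<eta>" using insert.prems by auto
  note pq' = roller_ev(2)[OF R(1) pq(1,2)] roller_ev(2)[OF R(2) pq(1,2)]
  obtain p' q' where "p' \<in> X" "q' \<in> X" "HI (a n) (b n) \<union> HI (\<xi> (iv p q)) (\<eta> (iv p q))
      \<subseteq> HI (\<xi> (iv p' q')) (\<eta> (iv p' q'))"
    using ufdiff_directed[OF R n(1,2) pq' n(3) HI_ev_sub_ufdiff[OF R pq(1,2)]] .
  then show ?case using pq by blast
qed

text \<open>The traces on the members of \<open>F\<close> are disjoint halfspace-intervals inside
  \<open>ufdiff \<xi> \<eta>\<close>. Directedness puts them into one \<open>HI\<close> between
  coordinates of \<open>\<xi>\<close> and \<open>\<eta>\<close>, whose measure is a distance bounded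
  by \<open>rho\<close>.\<close>

lemma sum_ufdiff_le_rho:
  assumes R: "\<xi> \<in> \<R>" "\<eta> \<in> \<R>" and "X \<noteq> {}" and F: "finite F" "F \<subseteq> halfspace_intervals X d" "pairwise disjnt F"
  shows "(\<Sum>A\<in>F. emeasure HM (ufdiff \<xi> \<eta> \<inter> A)) \<le> rho \<xi> \<eta>"
proof -
  define Q where "Q A s t \<longleftrightarrow> s \<in> X \<and> t \<in> X \<and> ufdiff \<xi> \<eta> \<inter> A = HI s t" for A s t
  have "\<exists>s t. Q A s t" if A: "A \<in> F" for A
  proof -
    obtain x y where "x \<in> X" "y \<in> X" "A = HI x y"
      using A F(2) unfolding halfspace_intervals_def by blast
    with HI_Int_ufdiff[OF R, of x y] show ?thesis unfolding Q_def by metis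
  qed
  then obtain s t where "\<And>A. A \<in> F \<Longrightarrow> Q A (s A) (t A)" by metis
  then have st: "s A \<in> X" "t A \<in> X" "ufdiff \<xi> \<eta> \<inter> A = HI (s A) (t A)" if "A \<in> F" for A
    using that by (auto simp: Q_def)
  have "\<exists>p\<in>X. \<exists>q\<in>X. (\<Union>A\<in>F. HI (s A) (t A)) \<subseteq> HI (\<xi> (iv p q)) (\<eta> (iv p q))"
    using st by (intro ufdiff_directed_finite R F assms) auto
  then obtain p q where pq: "p \<in> X" "q \<in> X"
    "(\<Union>A\<in>F. HI (s A) (t A)) \<subseteq> HI (\<xi> (iv p q)) (\<eta> (iv p q))" by auto
  have "(\<Sum>A\<in>F. emeasure HM (ufdiff \<xi> \<eta> \<inter> A)) = emeasure HM (\<Union>A\<in>F. ufdiff \<xi> \<eta> \<inter> A)"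
  proof (rule sum_emeasure)
    show "(\<lambda>A. ufdiff \<xi> \<eta> \<inter> A) ` F \<subseteq> sets HM" using st halfspace_measure_HI(1) by auto
    show "disjoint_family_on (\<lambda>A. ufdiff \<xi> \<eta> \<inter> A) F"
      using F(3) unfolding disjoint_family_on_def pairwise_def disjnt_def by blast
  qed (rule F)
  also have "\<dots> = emeasure HM (\<Union>A\<in>F. HI (s A) (t A))"
    using st by (intro arg_cong[where f = "emeasure HM"]) auto
  also have "\<dots> \<le> emeasure HM (HI (\<xi> (iv p q)) (\<eta> (iv p q)))"
    using pq R roller_ev by (intro emeasure_mono halfspace_measure_HI) auto
  also have "\<dots> = ennreal (d (\<xi> (iv p q)) (\<eta> (iv p q)))"
    using pq R roller_ev by (intro halfspace_measure_HI) auto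
  also have "\<dots> \<le> rho \<xi> \<eta>" using pq by (intro rho_upper)
  finally show ?thesis .
qed

lemma sym_diff_uf: "sym_diff (uf \<xi>) (uf \<eta>) = ufdiff \<xi> \<eta> \<union> ufdiff \<eta> \<xi>"
  using uf_sub by (auto simp: ufdiff_def)

lemma ufdiff_measurable:
  assumes R: "\<xi> \<in> \<R>" "\<eta> \<in> \<R>" and A: "A \<in> halfspace_intervals X d"
  shows "ufdiff \<xi> \<eta> \<inter> A \<in> sets HM"
proof -
  obtain x y where xy: "x \<in> X" "y \<in> X" "A = HI x y" using A by (auto simp: halfspace_intervals_def)
  show ?thesis using HI_Int_ufdiff[OF R xy(1,2)] halfspace_measure_HI(1) xy by metis
qed

lemma moral_measure_le:
  assumes R: "\<xi> \<in> \<R>" "\<eta> \<in> \<R>" and "X \<noteq> {}"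
  shows "moral_measure X d (sym_diff (uf \<xi>) (uf \<eta>)) \<le> rho \<xi> \<eta> * 2"
  unfolding moral_measure_def
proof (rule SUP_least)
  fix \<A> assume \<A>: "\<A> \<in> {\<A>. \<A> \<subseteq> halfspace_intervals X d \<and> pairwise disjnt \<A>}"
  show "(\<Sum>\<^sub>\<infinity>A\<in>\<A>. emeasure HM (sym_diff (uf \<xi>) (uf \<eta>) \<inter> A)) \<le> rho \<xi> \<eta> * 2"
  proof (rule infsum_le_finite_sums)
    fix F assume F: "finite F" "F \<subseteq> \<A>"
    have F': "F \<subseteq> halfspace_intervals X d" "pairwise disjnt F"
      using \<A> F pairwise_subset by blast+
    have "(\<Sum>A\<in>F. emeasure HM (sym_diff (uf \<xi>) (uf \<eta>) \<inter> A))
       \<le> (\<Sum>A\<in>F. emeasure HM (ufdiff \<xi> \<eta> \<inter> A) + emeasure HM (ufdiff \<eta> \<xi> \<inter> A))"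
      unfolding sym_diff_uf Int_Un_distrib2 using F' R
      by (intro sum_mono emeasure_subadditive ufdiff_measurable) auto
    also have "\<dots> \<le> rho \<xi> \<eta> + rho \<eta> \<xi>"
      unfolding sum.distrib using F F' R assms by (intro add_mono sum_ufdiff_le_rho) auto
    also have "\<dots> = rho \<xi> \<eta> * 2" by (simp add: rho_commute mult_2_right)
    finally show "(\<Sum>A\<in>F. emeasure HM (sym_diff (uf \<xi>) (uf \<eta>) \<inter> A)) \<le> rho \<xi> \<eta> * 2" .
  qed (rule nonneg_summable_on_complete, simp)
qed

lemma moral_measure_ge:
  assumes R: "\<xi> \<in> \<R>" "\<eta> \<in> \<R>" and X: "x \<in> X" "y \<in> X"
  shows "ennreal (d (\<xi> (iv x y)) (\<eta> (iv x y))) * 2 \<le> moral_measure X d (sym_diff (uf \<xi>) (uf \<eta>))"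
proof -
  \<comment> \<open>A halfspace separating \<open>?p\<close> and \<open>?q\<close> also separates
    \<open>x\<close> and \<open>y\<close>, so the family \<open>?F\<close> catches both halves of
    the symmetric difference. If \<open>x = y\<close>, its two members coincide and are
    empty.\<close>
  let ?p = "\<xi> (iv x y)" and ?q = "\<eta> (iv x y)" and ?E = "sym_diff (uf \<xi>) (uf \<eta>)" and ?F = "{HI x y, HI y x}"
  have pq: "?p \<in> X" "?q \<in> X" using roller_ev R X by auto
  have F: "?F \<subseteq> halfspace_intervals X d" "pairwise disjnt ?F"
    using X by (auto simp: halfspace_intervals_def pairwise_def disjnt_def HI_iff)
  have ms: "?E \<inter> A \<in> sets HM" if "A \<in> ?F" for A
    unfolding sym_diff_uf Int_Un_distrib2 using F that R by (intro sets.Un ufdiff_measurable) auto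
  have "ennreal (d ?p ?q) * 2 = emeasure HM (HI ?p ?q) + emeasure HM (HI ?q ?p)"
    using halfspace_measure_HI(2) pq by (simp add: commute mult_2_right)
  also have "\<dots> = emeasure HM (HI ?p ?q \<union> HI ?q ?p)"
    using halfspace_measure_HI(1) pq by (intro plus_emeasure) (auto simp: HI_iff)
  also have "\<dots> \<le> emeasure HM (\<Union>A\<in>?F. ?E \<inter> A)"
  proof (rule emeasure_mono)
    have "HI ?p ?q \<subseteq> HI x y \<union> HI y x" "HI ?q ?p \<subseteq> HI x y \<union> HI y x"
      using R X by (auto simp: HI_iff ev_in_halfspace)
    then show "HI ?p ?q \<union> HI ?q ?p \<subseteq> (\<Union>A\<in>?F. ?E \<inter> A)"
      unfolding sym_diff_uf
      using HI_ev_sub_ufdiff[OF R X] HI_ev_sub_ufdiff[OF R(2,1) X]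
      unfolding UN_insert UN_empty Un_empty_right Int_Un_distrib[symmetric] by (intro Un_least Int_greatest) auto
    show "(\<Union>A\<in>?F. ?E \<inter> A) \<in> sets HM" using ms by (intro sets.finite_UN) auto
  qed
  also have "\<dots> \<le> (\<Sum>A\<in>?F. emeasure HM (?E \<inter> A))"
    using ms by (intro emeasure_subadditive_finite) auto
  also have "\<dots> = (\<Sum>\<^sub>\<infinity>A\<in>?F. emeasure HM (?E \<inter> A))"
    by (intro infsum_finite[symmetric]) auto
  also have "\<dots> \<le> moral_measure X d ?E"
    unfolding moral_measure_def using F by (intro SUP_upper) auto
  finally show ?thesis .
qed

text \<open>The symmetric difference counts each separating halfspace together with its complement,
  and the division by two undoes this. Later arguments compute with \<open>rho\<close> instead of
  the moral measure.\<close>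

lemma roller_dist_eq_rho:
  assumes R: "\<xi> \<in> \<R>" "\<eta> \<in> \<R>" and "X \<noteq> {}"
  shows "roller_dist X d \<xi> \<eta> = rho \<xi> \<eta>"
  unfolding roller_dist_def
proof (rule antisym)
  have half: "(a * 2) / 2 = a" for a :: ennreal by (rule mult_divide_eq_ennreal) auto
  show "moral_measure X d (sym_diff (uf \<xi>) (uf \<eta>)) / 2 \<le> rho \<xi> \<eta>"
    using divide_right_mono_ennreal[OF moral_measure_le[OF assms], of 2] by (simp add: half)
  show "rho \<xi> \<eta> \<le> moral_measure X d (sym_diff (uf \<xi>) (uf \<eta>)) / 2"
  proof (rule rho_least)
    fix x y assume "x \<in> X" "y \<in> X"
    then show "ennreal (d (\<xi> (iv x y)) (\<eta> (iv x y))) \<le> moral_measure X d (sym_diff (uf \<xi>) (uf \<eta>)) / 2"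
      using divide_right_mono_ennreal[OF moral_measure_ge[OF R], of x y 2] by (simp add: half)
  qed
qed

end


section \<open>Components\<close>

lemma SUP_plus_SUP_le_ennreal:
  fixes f :: "'i \<Rightarrow> ennreal" and g :: "'j \<Rightarrow> ennreal"
  assumes "I \<noteq> {}" "J \<noteq> {}" "\<And>i j. i \<in> I \<Longrightarrow> j \<in> J \<Longrightarrow> f i + g j \<le> B"
  shows "(SUP i\<in>I. f i) + (SUP j\<in>J. g j) \<le> B"
proof -
  have "f i + (SUP j\<in>J. g j) \<le> B" if "i \<in> I" for i
    using assms that ennreal_SUP_add_right[of J "f i" g] by (auto intro: SUP_least)
  then have "(SUP i\<in>I. f i + (SUP j\<in>J. g j)) \<le> B" by (rule SUP_least)
  then show ?thesis by (simp add: ennreal_SUP_add_left assms)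
qed

context median_space
begin

section \<open>Triangle inequality and betweenness for \<open>rho\<close>\<close>

lemma rho_self: "\<xi> \<in> \<R> \<Longrightarrow> rho \<xi> \<xi> = 0"
proof -
  assume xi: "\<xi> \<in> \<R>"
  have "rho \<xi> \<xi> \<le> 0" by (rule rho_least) (simp add: roller_ev(2)[OF xi])
  then show ?thesis by simp
qed

lemma rho_eq_0:
  assumes R: "\<xi> \<in> \<R>" "\<eta> \<in> \<R>" and "rho \<xi> \<eta> = 0"
  shows "\<xi> = \<eta>"
proof (rule PiE_ext)
  show "\<xi> \<in> (\<Pi>\<^sub>E I\<in>intervals X d. I)" "\<eta> \<in> (\<Pi>\<^sub>E I\<in>intervals X d. I)"
    using roller_PiE R by blast+
  fix I assume "I \<in> intervals X d"
  then obtain x y where xy: "x \<in> X" "y \<in> X" "I = iv x y" by (rule intervalsE)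
  have "d (\<xi> I) (\<eta> I) \<le> 0"
    using rho_upper[of x y \<xi> \<eta>] xy assms by simp
  then have "d (\<xi> I) (\<eta> I) = 0" using nonneg[of "\<xi> I" "\<eta> I"] by linarith
  then show "\<xi> I = \<eta> I" using xy roller_ev(2)[OF R(1) xy(1,2)] roller_ev(2)[OF R(2) xy(1,2)] by simp
qed

lemma rho_triangle:
  assumes R: "\<xi> \<in> \<R>" "\<eta> \<in> \<R>" "\<zeta> \<in> \<R>"
  shows "rho \<xi> \<zeta> \<le> rho \<xi> \<eta> + rho \<eta> \<zeta>"
proof (rule rho_least)
  fix x y assume X: "x \<in> X" "y \<in> X"
  have "ennreal (d (\<xi> (iv x y)) (\<zeta> (iv x y))) \<le>
      ennreal (d (\<xi> (iv x y)) (\<eta> (iv x y)) + d (\<eta> (iv x y)) (\<zeta> (iv x y)))"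
    using triangle R X roller_ev(2) by (intro ennreal_leI) auto
  also have "\<dots> \<le> rho \<xi> \<eta> + rho \<eta> \<zeta>"
    using X by (simp add: ennreal_plus add_mono rho_upper)
  finally show "ennreal (d (\<xi> (iv x y)) (\<zeta> (iv x y))) \<le> rho \<xi> \<eta> + rho \<eta> \<zeta>" .
qed

text \<open>By \<open>component_interval_iff\<close> below this is metric betweenness within a component.\<close>

definition rbetween :: "('a set \<Rightarrow> 'a) \<Rightarrow> ('a set \<Rightarrow> 'a) \<Rightarrow> ('a set \<Rightarrow> 'a) \<Rightarrow> bool" where
  "rbetween \<xi> \<zeta> \<eta> \<longleftrightarrow> (\<forall>h\<in>\<H>. (h \<in> uf \<xi> \<and> h \<in> uf \<eta> \<longrightarrow> h \<in> uf \<zeta>) \<and> (h \<in> uf \<zeta> \<longrightarrow> h \<in> uf \<xi> \<or> h \<in> uf \<eta>))"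

text \<open>Distances contributing to the two suprema on the right live in different intervals
  \<open>iv x y\<close> and \<open>iv z w\<close>. Both are transferred, without loss, to a common
  interval \<open>iv p q\<close>, where the coordinate of \<open>\<zeta>\<close> lies between those
  of \<open>\<xi>\<close> and \<open>\<eta>\<close>.\<close>

lemma rho_between:
  assumes R: "\<xi> \<in> \<R>" "\<zeta> \<in> \<R>" "\<eta> \<in> \<R>" and bt: "rbetween \<xi> \<zeta> \<eta>" and ne: "X \<noteq> {}"
  shows "rho \<xi> \<eta> = rho \<xi> \<zeta> + rho \<zeta> \<eta>"
proof (rule antisym)
  show "rho \<xi> \<eta> \<le> rho \<xi> \<zeta> + rho \<zeta> \<eta>" using rho_triangle R by simp
  have "ennreal (d (\<xi> (iv x y)) (\<zeta> (iv x y))) + ennreal (d (\<zeta> (iv z w)) (\<eta> (iv z w))) \<le> rho \<xi> \<eta>"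
    if X: "x \<in> X" "y \<in> X" "z \<in> X" "w \<in> X" for x y z w
  proof -
    define a b c e where "a = \<xi> (iv x y)" and "b = \<zeta> (iv x y)" and "c = \<zeta> (iv z w)" and "e = \<eta> (iv z w)"
    have abce: "a \<in> X" "b \<in> X" "c \<in> X" "e \<in> X"
      using roller_ev(2) R X unfolding a_def b_def c_def e_def by auto
    \<comment> \<open>The same witnesses as in \<open>ufdiff_directed\<close>.\<close>
    define p q where "p = \<xi> (iv a c)" and "q = \<eta> (iv b e)"
    have pq: "p \<in> X" "q \<in> X" using roller_ev(2) R abce unfolding p_def q_def by auto
    define a' b' e' where "a' = \<xi> (iv p q)" and "b' = \<zeta> (iv p q)" and "e' = \<eta> (iv p q)"
    have abe': "a' \<in> X" "b' \<in> X" "e' \<in> X"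
      using roller_ev(2) R pq unfolding a'_def b'_def e'_def by auto
    have pqh: "p \<in> h \<longleftrightarrow> (a \<in> h \<and> c \<in> h \<or> a \<in> h \<and> h \<in> uf \<xi> \<or> c \<in> h \<and> h \<in> uf \<xi>)"
        "q \<in> h \<longleftrightarrow> (b \<in> h \<and> e \<in> h \<or> b \<in> h \<and> h \<in> uf \<eta> \<or> e \<in> h \<and> h \<in> uf \<eta>)"
      if "h \<in> \<H>" for h
      unfolding p_def q_def using that ev_in_halfspace R abce by blast+
    have h': "a' \<in> h \<longleftrightarrow> (p \<in> h \<and> q \<in> h \<or> p \<in> h \<and> h \<in> uf \<xi> \<or> q \<in> h \<and> h \<in> uf \<xi>)"
        "b' \<in> h \<longleftrightarrow> (p \<in> h \<and> q \<in> h \<or> p \<in> h \<and> h \<in> uf \<zeta> \<or> q \<in> h \<and> h \<in> uf \<zeta>)"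
        "e' \<in> h \<longleftrightarrow> (p \<in> h \<and> q \<in> h \<or> p \<in> h \<and> h \<in> uf \<eta> \<or> q \<in> h \<and> h \<in> uf \<eta>)"
      if "h \<in> \<H>" for h
      unfolding a'_def b'_def e'_def using that ev_in_halfspace R pq by blast+
    have btD: "h \<in> uf \<xi> \<Longrightarrow> h \<in> uf \<eta> \<Longrightarrow> h \<in> uf \<zeta>" "h \<in> uf \<zeta> \<Longrightarrow> h \<in> uf \<xi> \<or> h \<in> uf \<eta>"
      if "h \<in> \<H>" for h using bt that unfolding rbetween_def by blast+
    have "HI a b \<subseteq> HI a' b'"
    proof
      fix h assume h: "h \<in> HI a b"
      then have "h \<in> ufdiff \<xi> \<zeta>" using HI_ev_sub_ufdiff[OF R(1,2) X(1,2)] unfolding a_def b_def by blast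
      then show "h \<in> HI a' b'" using h h'[of h] pqh[of h] btD[of h] unfolding HI_iff ufdiff_def by blast
    qed
    then have 1: "d a b \<le> d a' b'" using dist_mono_HI abce abe' by auto
    have "HI c e \<subseteq> HI b' e'"
    proof
      fix h assume h: "h \<in> HI c e"
      then have "h \<in> ufdiff \<zeta> \<eta>" using HI_ev_sub_ufdiff[OF R(2,3) X(3,4)] unfolding c_def e_def by blast
      then show "h \<in> HI b' e'" using h h'[of h] pqh[of h] btD[of h] unfolding HI_iff ufdiff_def by blast
    qed
    then have 2: "d c e \<le> d b' e'" using dist_mono_HI abce abe' by auto
    have "b' \<in> iv a' e'"
    proof (rule iv_by_halfspaces)
      fix h assume "h \<in> \<H>" "a' \<in> h" "e' \<in> h"
      then show "b' \<in> h" using h'[of h] btD[of h] by blast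
    qed (use abe' in auto)
    then have "d a b + d c e \<le> d a' e'" using 1 2 by (simp add: iv_iff)
    then have "ennreal (d a b) + ennreal (d c e) \<le> ennreal (d a' e')"
      by (simp add: ennreal_plus[symmetric] ennreal_leI del: ennreal_plus)
    also have "\<dots> \<le> rho \<xi> \<eta>" unfolding a'_def e'_def using pq by (rule rho_upper)
    finally show ?thesis unfolding a_def b_def c_def e_def .
  qed
  then show "rho \<xi> \<zeta> + rho \<zeta> \<eta> \<le> rho \<xi> \<eta>"
    unfolding rho_def[of \<xi> \<zeta>] rho_def[of \<zeta> \<eta>] using ne
    by (intro SUP_plus_SUP_le_ennreal) auto
qed

section \<open>Points at finite distance from the space\<close>

lemma rho_emb:
  assumes X: "x \<in> X" "y \<in> X"
  shows "rho (emb x) (emb y) = ennreal (d x y)"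
proof (rule antisym)
  show "rho (emb x) (emb y) \<le> ennreal (d x y)"
    using X by (intro rho_least) (simp add: emb_iv med_lipschitz ennreal_leI)
  have "emb x (iv x y) = x" "emb y (iv x y) = y" using X by (auto simp: emb_iv med_absorb)
  then show "ennreal (d x y) \<le> rho (emb x) (emb y)"
    using rho_upper[OF X, of "emb x" "emb y"] by simp
qed

text \<open>In a suitable interval \<open>iv a b\<close> the coordinates \<open>p'\<close> of
  \<open>p\<close> and \<open>q'\<close> of \<open>\<xi>\<close> nearly realise the finite distance.
  The point \<open>y = m(p, q', \<xi>)\<close> lies between \<open>p\<close> and
  \<open>\<xi>\<close>, at distance at least \<open>d p' q'\<close> from \<open>p\<close>, so little
  remains between \<open>y\<close> and \<open>\<xi>\<close>.\<close>

lemma finite_distance_approx: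
  assumes xi: "\<xi> \<in> \<R>" and p: "p \<in> X" and fin: "rho (emb p) \<xi> < top" and "0 < (\<epsilon>::real)"
  shows "\<exists>y\<in>X. rho (emb y) \<xi> \<le> ennreal \<epsilon>"
proof -
  have ne: "X \<noteq> {}" using p by auto
  have "\<exists>a\<in>X. \<exists>b\<in>X. rho (emb p) \<xi> < ennreal (d (emb p (iv a b)) (\<xi> (iv a b))) + ennreal \<epsilon>"
  proof (rule ccontr)
    assume "\<not> ?thesis"
    then have "(SUP (a, b)\<in>X \<times> X. ennreal (d (emb p (iv a b)) (\<xi> (iv a b))) + ennreal \<epsilon>) \<le> rho (emb p) \<xi>"
      by (intro SUP_least) (auto simp: not_less)
    then have "rho (emb p) \<xi> + ennreal \<epsilon> \<le> rho (emb p) \<xi>"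
      using ne unfolding rho_def[of "emb p" \<xi>] by (simp add: split_def ennreal_SUP_add_left)
    then show False using fin \<open>0 < \<epsilon>\<close>
      by (cases "rho (emb p) \<xi>") (auto simp: ennreal_plus[symmetric] simp del: ennreal_plus)
  qed
  then obtain a b where ab: "a \<in> X" "b \<in> X"
    and less: "rho (emb p) \<xi> < ennreal (d (emb p (iv a b)) (\<xi> (iv a b))) + ennreal \<epsilon>" by auto
  define p' q' y where "p' = emb p (iv a b)" and "q' = \<xi> (iv a b)" and "y = \<xi> (iv p q')"
  have X: "p' \<in> X" "q' \<in> X" "y \<in> X"
    using roller_ev(2) xi p ab emb_in_roller unfolding p'_def q'_def y_def by auto
  have yh: "y \<in> h \<longleftrightarrow> (p \<in> h \<and> q' \<in> h \<or> p \<in> h \<and> h \<in> uf \<xi> \<or> q' \<in> h \<and> h \<in> uf \<xi>)" if "h \<in> \<H>" for h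
    unfolding y_def using that ev_in_halfspace xi p X by blast
  have "HI p' q' \<subseteq> HI p y"
  proof
    fix h assume h: "h \<in> HI p' q'"
    then have "h \<in> ufdiff (emb p) \<xi>"
      using HI_ev_sub_ufdiff[OF emb_in_roller[OF p] xi ab] unfolding p'_def q'_def by blast
    then show "h \<in> HI p y" using h yh[of h] uf_emb[OF p, of h] unfolding HI_iff ufdiff_def by blast
  qed
  then have le: "d p' q' \<le> d p y" using dist_mono_HI p X by auto
  have "rbetween (emb p) (emb y) \<xi>"
    unfolding rbetween_def using yh uf_emb p X by blast
  then have eq: "rho (emb p) \<xi> = ennreal (d p y) + rho (emb y) \<xi>"
    using rho_between[of "emb p" "emb y" \<xi>] rho_emb p X xi emb_in_roller ne by auto
  have "ennreal (d p' q') + rho (emb y) \<xi> \<le> rho (emb p) \<xi>"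
    unfolding eq using le by (intro add_right_mono ennreal_leI)
  also have "\<dots> \<le> ennreal (d p' q') + ennreal \<epsilon>"
    using less unfolding p'_def q'_def by (rule less_imp_le)
  finally have "ennreal (d p' q') + rho (emb y) \<xi> \<le> ennreal (d p' q') + ennreal \<epsilon>" .
  then have "rho (emb y) \<xi> \<le> ennreal \<epsilon>" by (subst (asm) ennreal_add_left_cancel_le) simp
  then show ?thesis using X(3) by blast
qed

text \<open>The approximating points form a Cauchy sequence in \<open>X\<close>, and completeness
  supplies a limit at distance zero from \<open>\<xi>\<close>.\<close>

lemma finite_distance_in_space:
  assumes cmp: "mcomplete" and xi: "\<xi> \<in> \<R>" and p: "p \<in> X" and fin: "rho (emb p) \<xi> < top"
  shows "\<xi> \<in> emb ` X"
proof -
  have "\<exists>y\<in>X. rho (emb y) \<xi> \<le> ennreal (inverse (real (Suc n)))" for n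
    by (rule finite_distance_approx[OF xi p fin]) simp
  then obtain y where y: "\<And>n. y n \<in> X" "\<And>n. rho (emb (y n)) \<xi> \<le> ennreal (inverse (real (Suc n)))"
    by metis
  have dy: "d (y n) (y m) \<le> inverse (real (Suc n)) + inverse (real (Suc m))" for n m
  proof -
    have "ennreal (d (y n) (y m)) \<le> rho (emb (y n)) \<xi> + rho \<xi> (emb (y m))"
      using rho_triangle[of "emb (y n)" \<xi> "emb (y m)"] rho_emb y xi emb_in_roller by auto
    also have "\<dots> \<le> ennreal (inverse (real (Suc n))) + ennreal (inverse (real (Suc m)))"
      using y rho_commute[of \<xi>] by (intro add_mono) auto
    also have "\<dots> = ennreal (inverse (real (Suc n)) + inverse (real (Suc m)))"
      by (simp add: ennreal_plus[symmetric] del: ennreal_plus)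
    finally show ?thesis by (subst (asm) ennreal_le_iff) auto
  qed
  have small: "\<exists>N. \<forall>n\<ge>N. inverse (real (Suc n)) < \<epsilon>" if "0 < \<epsilon>" for \<epsilon> :: real
  proof -
    obtain N where N: "inverse (real (Suc N)) < \<epsilon>" using reals_Archimedean[OF \<open>0 < \<epsilon>\<close>] by auto
    have "inverse (real (Suc n)) \<le> inverse (real (Suc N))" if "n \<ge> N" for n
      using that by (intro le_imp_inverse_le) auto
    then show ?thesis using N by (meson le_less_trans)
  qed
  have "MCauchy y"
    unfolding MCauchy_def
  proof (intro conjI allI impI)
    show "range y \<subseteq> X" using y by auto
    fix \<epsilon> :: real assume "0 < \<epsilon>"
    then obtain N where N: "\<forall>n\<ge>N. inverse (real (Suc n)) < \<epsilon> / 2" using small[of "\<epsilon> / 2"] by auto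
    have "d (y n) (y m) < \<epsilon>" if "n \<ge> N" "m \<ge> N" for n m
      using dy[of n m] N[rule_format, OF that(1)] N[rule_format, OF that(2)] by linarith
    then show "\<exists>N. \<forall>n n'. N \<le> n \<longrightarrow> N \<le> n' \<longrightarrow> d (y n) (y n') < \<epsilon>" by blast
  qed
  then obtain x where "limitin mtopology y x sequentially" using cmp unfolding mcomplete_def by blast
  then have x: "x \<in> X" and lim: "\<And>\<epsilon>. 0 < \<epsilon> \<Longrightarrow> \<exists>N. \<forall>n\<ge>N. d (y n) x < \<epsilon>"
    unfolding limit_metric_sequentially by blast+
  have "rho (emb x) \<xi> \<le> 0"
  proof (rule ennreal_le_epsilon)
    fix \<epsilon> :: real assume "0 < \<epsilon>"
    then obtain N M where N: "\<forall>n\<ge>N. inverse (real (Suc n)) < \<epsilon> / 2" and M: "\<forall>n\<ge>M. d (y n) x < \<epsilon> / 2"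
      using small[of "\<epsilon> / 2"] lim[of "\<epsilon> / 2"] by auto
    define n where "n = max N M"
    have n: "inverse (real (Suc n)) < \<epsilon> / 2" "d (y n) x < \<epsilon> / 2" using N M unfolding n_def by (meson max.cobounded1 max.cobounded2)+
    have "rho (emb x) \<xi> \<le> rho (emb x) (emb (y n)) + rho (emb (y n)) \<xi>"
      using rho_triangle x y xi emb_in_roller by auto
    also have "\<dots> \<le> ennreal (d x (y n)) + ennreal (inverse (real (Suc n)))"
      using rho_emb x y by (intro add_mono) auto
    also have "\<dots> = ennreal (d x (y n) + inverse (real (Suc n)))"
      by (simp add: ennreal_plus[symmetric] del: ennreal_plus)
    also have "\<dots> \<le> ennreal \<epsilon>" using n commute[of x "y n"] by (intro ennreal_leI) linarith
    finally show "rho (emb x) \<xi> \<le> 0 + ennreal \<epsilon>" by simp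
  qed
  then have "emb x = \<xi>" using rho_eq_0[OF emb_in_roller[OF x] xi] by simp
  then show ?thesis using x by blast
qed

end

section \<open>Components as complete median spaces\<close>

locale roller_component = median_space X d for X :: "'a set" and d +
  fixes C :: "('a set \<Rightarrow> 'a) set" and \<xi>\<^sub>0 :: "'a set \<Rightarrow> 'a"
  assumes X_nonempty: "X \<noteq> {}" and base_in_roller: "\<xi>\<^sub>0 \<in> \<R>"
    and C_eq: "C = {\<eta> \<in> \<R>. rho \<xi>\<^sub>0 \<eta> < top}"
begin

abbreviation D :: "('a set \<Rightarrow> 'a) \<Rightarrow> ('a set \<Rightarrow> 'a) \<Rightarrow> real" where "D \<equiv> component_dist X d"

lemma C_roller: "\<xi> \<in> C \<Longrightarrow> \<xi> \<in> \<R>"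
  by (simp add: C_eq)

lemma base_in_C: "\<xi>\<^sub>0 \<in> C"
  using base_in_roller rho_self by (simp add: C_eq)

lemma rho_finite:
  assumes "\<xi> \<in> C" "\<eta> \<in> C" shows "rho \<xi> \<eta> < top"
proof -
  have "rho \<xi> \<eta> \<le> rho \<xi> \<xi>\<^sub>0 + rho \<xi>\<^sub>0 \<eta>" using rho_triangle assms C_roller base_in_roller by auto
  also have "\<dots> < top" using assms rho_commute[of \<xi>] by (auto simp: C_eq)
  finally show ?thesis .
qed

lemma C_closed: "\<xi> \<in> C \<Longrightarrow> \<eta> \<in> \<R> \<Longrightarrow> rho \<xi> \<eta> < top \<Longrightarrow> \<eta> \<in> C"
  using rho_triangle[of \<xi>\<^sub>0 \<xi> \<eta>] base_in_roller
  by (auto simp: C_eq intro: le_less_trans)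

lemma ennreal_D: "\<xi> \<in> C \<Longrightarrow> \<eta> \<in> C \<Longrightarrow> ennreal (D \<xi> \<eta>) = rho \<xi> \<eta>"
  using roller_dist_eq_rho[OF C_roller C_roller X_nonempty] rho_finite by (simp add: component_dist_def)

lemma D_le_iff: "\<xi> \<in> C \<Longrightarrow> \<eta> \<in> C \<Longrightarrow> 0 \<le> c \<Longrightarrow> D \<xi> \<eta> \<le> c \<longleftrightarrow> rho \<xi> \<eta> \<le> ennreal c"
  using ennreal_D[of \<xi> \<eta>] ennreal_le_iff[of c "D \<xi> \<eta>"] by simp

lemma D_nonneg: "0 \<le> D \<xi> \<eta>"
  by (simp add: component_dist_def)

lemma D_add_iff:
  assumes "\<xi> \<in> C" "\<eta> \<in> C" "\<zeta> \<in> C"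
  shows "D \<xi> \<eta> = D \<xi> \<zeta> + D \<zeta> \<eta> \<longleftrightarrow> rho \<xi> \<eta> = rho \<xi> \<zeta> + rho \<zeta> \<eta>"
proof -
  have "rho \<xi> \<zeta> + rho \<zeta> \<eta> = ennreal (D \<xi> \<zeta> + D \<zeta> \<eta>)"
    using assms D_nonneg by (simp add: ennreal_D)
  moreover have "rho \<xi> \<eta> = ennreal (D \<xi> \<eta>)" using assms by (simp add: ennreal_D)
  ultimately show ?thesis using D_nonneg by (simp add: ennreal_inj del: ennreal_plus)
qed

lemma coordinate_le_D:
  assumes "\<xi> \<in> C" "\<eta> \<in> C" "x \<in> X" "y \<in> X"
  shows "d (\<xi> (iv x y)) (\<eta> (iv x y)) \<le> D \<xi> \<eta>"
  using rho_upper[of x y \<xi> \<eta>] assms D_nonneg by (simp flip: ennreal_D)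

lemma metric_component: "Metric_space C D"
proof
  fix \<xi> \<eta> \<zeta>
  show "0 \<le> D \<xi> \<eta>" by (rule D_nonneg)
  show "D \<xi> \<eta> = D \<eta> \<xi>" by (simp add: component_dist_def roller_dist_def Un_commute)
  show "D \<xi> \<eta> = 0 \<longleftrightarrow> \<xi> = \<eta>" if "\<xi> \<in> C" "\<eta> \<in> C"
    using that ennreal_D[of \<xi> \<eta>] rho_eq_0[of \<xi> \<eta>] rho_self[of \<xi>] C_roller D_nonneg[of \<xi> \<eta>] by auto
  show "D \<xi> \<zeta> \<le> D \<xi> \<eta> + D \<eta> \<zeta>" if "\<xi> \<in> C" "\<eta> \<in> C" "\<zeta> \<in> C"
    using that rho_triangle[of \<xi> \<eta> \<zeta>] C_roller D_nonneg
    by (subst D_le_iff) (auto simp: ennreal_D)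
qed

lemma rmed_in_C:
  assumes C: "\<xi> \<in> C" "\<eta> \<in> C" "\<zeta> \<in> \<R>" shows "rmed \<xi> \<eta> \<zeta> \<in> C"
proof -
  have R: "\<xi> \<in> \<R>" "\<eta> \<in> \<R>" "rmed \<xi> \<eta> \<zeta> \<in> \<R>" using C C_roller rmed_in_roller by auto
  have "rbetween \<xi> (rmed \<xi> \<eta> \<zeta>) \<eta>"
    unfolding rbetween_def using uf_rmed[OF R(1,2) C(3)] by auto
  then have "rho \<xi> (rmed \<xi> \<eta> \<zeta>) \<le> rho \<xi> \<eta>"
    using rho_between[OF R(1,3,2) _ X_nonempty] by simp
  then show ?thesis using rho_finite[OF C(1,2)] by (intro C_closed[OF C(1)] R) auto
qed

text \<open>If the distances through \<open>\<zeta>\<close> add up, compare with the median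
  \<open>?m\<close> of the three points. It lies between each two of them, so adding the three
  distance identities leaves \<open>D \<zeta> ?m = 0\<close>. The other direction is
  \<open>rho_between\<close>.\<close>

lemma component_interval_iff:
  assumes C: "\<xi> \<in> C" "\<eta> \<in> C"
  shows "\<zeta> \<in> interval C D \<xi> \<eta> \<longleftrightarrow> \<zeta> \<in> C \<and> rbetween \<xi> \<zeta> \<eta>"
proof (cases "\<zeta> \<in> C")
  case True
  note R = C(1)[THEN C_roller] C(2)[THEN C_roller] True[THEN C_roller]
  let ?m = "rmed \<xi> \<eta> \<zeta>"
  have m: "?m \<in> C" "?m \<in> \<R>" using rmed_in_C[OF C R(3)] C_roller by auto
  have bt: "rbetween \<xi> ?m \<eta>" "rbetween \<xi> ?m \<zeta>" "rbetween \<zeta> ?m \<eta>"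
    unfolding rbetween_def using uf_rmed[OF R] by auto
  have "rbetween \<xi> \<zeta> \<eta>" if eq: "rho \<xi> \<eta> = rho \<xi> \<zeta> + rho \<zeta> \<eta>"
  proof -
    have "D \<xi> \<eta> = D \<xi> \<zeta> + D \<zeta> \<eta>" using eq D_add_iff C True by auto
    moreover have "D \<xi> \<eta> = D \<xi> ?m + D ?m \<eta>" "D \<xi> \<zeta> = D \<xi> ?m + D ?m \<zeta>" "D \<zeta> \<eta> = D \<zeta> ?m + D ?m \<eta>"
      using rho_between bt R m X_nonempty D_add_iff C True by auto
    moreover have "D \<zeta> ?m = D ?m \<zeta>" using Metric_space.commute[OF metric_component] .
    ultimately have "D \<zeta> ?m = 0" by linarith
    then have "\<zeta> = ?m" using Metric_space.zero[OF metric_component True m(1)] by simp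
    then show ?thesis using bt(1) by simp
  qed
  moreover have "rho \<xi> \<eta> = rho \<xi> \<zeta> + rho \<zeta> \<eta>" if "rbetween \<xi> \<zeta> \<eta>"
    using rho_between[OF R(1,3,2) that X_nonempty] .
  ultimately show ?thesis using True D_add_iff[OF C True] by (auto simp: interval_def)
qed (simp add: interval_def)

text \<open>Lying in the three intervals prescribes, for every halfspace, the majority vote of the
  three ultrafilters, and \<open>roller_eqI\<close> recovers the point from these votes.\<close>

lemma component_median_unique:
  assumes C: "\<xi> \<in> C" "\<eta> \<in> C" "\<zeta> \<in> C"
  shows "p \<in> interval C D \<xi> \<eta> \<inter> interval C D \<eta> \<zeta> \<inter> interval C D \<zeta> \<xi> \<longleftrightarrow> p = rmed \<xi> \<eta> \<zeta>"
proof
  note R = C(1)[THEN C_roller] C(2)[THEN C_roller] C(3)[THEN C_roller]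
  note uf = uf_rmed[OF R]
  show "p = rmed \<xi> \<eta> \<zeta>" if p: "p \<in> interval C D \<xi> \<eta> \<inter> interval C D \<eta> \<zeta> \<inter> interval C D \<zeta> \<xi>"
  proof (rule roller_eqI)
    have "p \<in> C" "rbetween \<xi> p \<eta>" "rbetween \<eta> p \<zeta>" "rbetween \<zeta> p \<xi>"
      using p component_interval_iff C by auto
    then show "p \<in> \<R>" "\<And>h. h \<in> \<H> \<Longrightarrow> h \<in> uf p \<longleftrightarrow> h \<in> uf (rmed \<xi> \<eta> \<zeta>)"
      using uf C_roller unfolding rbetween_def by blast+
    show "rmed \<xi> \<eta> \<zeta> \<in> \<R>" using rmed_in_roller R .
  qed
  show "p \<in> interval C D \<xi> \<eta> \<inter> interval C D \<eta> \<zeta> \<inter> interval C D \<zeta> \<xi>" if "p = rmed \<xi> \<eta> \<zeta>"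
    using that rmed_in_C[OF C(1,2) R(3)] component_interval_iff C uf unfolding rbetween_def by auto
qed

lemma median_space_component: "median_space C D"
  unfolding median_space_def median_space_axioms_def
  using metric_component component_median_unique by simp

lemma median_component_eq:
  assumes "\<xi> \<in> C" "\<eta> \<in> C" "\<zeta> \<in> C"
  shows "median C D \<xi> \<eta> \<zeta> = rmed \<xi> \<eta> \<zeta>"
  unfolding median_def using component_median_unique[OF assms] by simp

text \<open>Each coordinate is 1-Lipschitz, so coordinatewise limits exist in \<open>X\<close>. The
  conditions defining \<open>roller\<close> pass to the limit because projections are 1-Lipschitz,
  and convergence is uniform over all intervals.\<close>

lemma mcomplete_component:
  assumes cmp: "mcomplete"
  shows "Metric_space.mcomplete C D"
  unfolding Metric_space.mcomplete_def[OF metric_component]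
proof (intro allI impI)
  interpret C: Metric_space C D by (rule metric_component)
  fix s assume "C.MCauchy s"
  then have sC: "s n \<in> C" and cau: "0 < \<epsilon> \<Longrightarrow> \<exists>N. \<forall>n m. N \<le> n \<longrightarrow> N \<le> m \<longrightarrow> D (s n) (s m) < \<epsilon>" for n \<epsilon>
    unfolding C.MCauchy_def by auto
  define l where "l = (\<lambda>I\<in>intervals X d. SOME z. limitin mtopology (\<lambda>n. s n I) z sequentially)"
  have sX: "s n (iv x y) \<in> X" "s n (iv x y) \<in> iv x y" if "x \<in> X" "y \<in> X" for n x y
    using that roller_ev sC C_roller by auto
  have l: "limitin mtopology (\<lambda>n. s n (iv x y)) (l (iv x y)) sequentially" if X: "x \<in> X" "y \<in> X" for x y
  proof -
    have "MCauchy (\<lambda>n. s n (iv x y))"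
      unfolding MCauchy_def
    proof (intro conjI allI impI)
      show "range (\<lambda>n. s n (iv x y)) \<subseteq> X" using sX X by auto
      fix \<epsilon> :: real assume "0 < \<epsilon>"
      then show "\<exists>N. \<forall>n m. N \<le> n \<longrightarrow> N \<le> m \<longrightarrow> d (s n (iv x y)) (s m (iv x y)) < \<epsilon>"
        using cau coordinate_le_D[OF sC sC X] by (meson le_less_trans)
    qed
    then have "\<exists>z. limitin mtopology (\<lambda>n. s n (iv x y)) z sequentially"
      using cmp unfolding mcomplete_def by blast
    then show ?thesis unfolding l_def using X by (simp add: someI_ex[of "\<lambda>z. limitin mtopology (\<lambda>n. s n (iv x y)) z sequentially"])
  qed
  have lX: "l (iv x y) \<in> X" 
    and lim: "0 < \<epsilon> \<Longrightarrow> \<exists>N. \<forall>n\<ge>N. d (s n (iv x y)) (l (iv x y)) < \<epsilon>" if "x \<in> X" "y \<in> X" for x y \<epsilon>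
    using l[OF that] unfolding limit_metric_sequentially by (simp, meson)
  have lR: "l \<in> \<R>"
  proof (rule rollerI)
    show "l \<in> extensional (intervals X d)" by (simp add: l_def)
    fix x y assume X: "x \<in> X" "y \<in> X"
    \<comment> \<open>An interval consists of the fixed points of its projection.\<close>
    have "d (l (iv x y)) (med x y (l (iv x y))) \<le> 0"
    proof (rule field_le_epsilon)
      fix \<epsilon> :: real assume "0 < \<epsilon>"
      then obtain n where n: "d (s n (iv x y)) (l (iv x y)) < \<epsilon> / 2" using lim[OF X, of "\<epsilon> / 2"] by auto
      have "med x y (s n (iv x y)) = s n (iv x y)" using med_absorb sX X by auto
      then show "d (l (iv x y)) (med x y (l (iv x y))) \<le> 0 + \<epsilon>"
        using n med_lipschitz[OF X sX(1)[OF X, of n] lX[OF X]] commute[of "l (iv x y)" "s n (iv x y)"]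
          triangle[OF lX[OF X] sX(1)[OF X, of n] med_iv(1)[OF X lX[OF X]]] by simp
    qed
    then have "d (l (iv x y)) (med x y (l (iv x y))) = 0"
      using nonneg[of "l (iv x y)" "med x y (l (iv x y))"] by linarith
    then have "l (iv x y) = med x y (l (iv x y))" using lX[OF X] med_iv(1)[OF X] by auto
    then show "l (iv x y) \<in> iv x y" using med_iv(2)[OF X lX[OF X]] by simp
  next
    fix a b c e g k assume X: "a \<in> X" "b \<in> X" "c \<in> X" "e \<in> X" "g \<in> X" "k \<in> X"
      and eq: "iv a b \<inter> iv c e = iv g k"
    let ?p = "med g k (l (iv a b))" and ?q = "med g k (l (iv c e))"
    have pq: "?p \<in> X" "?q \<in> X" using med_iv lX X by auto
    have "d ?p ?q \<le> 0"
    proof (rule field_le_epsilon)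
      fix \<epsilon> :: real assume "0 < \<epsilon>"
      then obtain N M where "\<forall>n\<ge>N. d (s n (iv a b)) (l (iv a b)) < \<epsilon> / 2"
        "\<forall>n\<ge>M. d (s n (iv c e)) (l (iv c e)) < \<epsilon> / 2"
        using lim[OF X(1,2), of "\<epsilon> / 2"] lim[OF X(3,4), of "\<epsilon> / 2"] by auto
      then obtain n where n: "d (s n (iv a b)) (l (iv a b)) < \<epsilon> / 2" "d (s n (iv c e)) (l (iv c e)) < \<epsilon> / 2"
        by (meson max.cobounded1 max.cobounded2)
      let ?r = "med g k (s n (iv a b))"
      have "?r \<in> X" using med_iv sX X by auto
      moreover have "d ?r ?p \<le> d (s n (iv a b)) (l (iv a b))"
        using med_lipschitz X sX lX by auto
      moreover have "?r = med g k (s n (iv c e))"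
        using roller_consistent[OF C_roller[OF sC] X eq] .
      then have "d ?r ?q \<le> d (s n (iv c e)) (l (iv c e))"
        using med_lipschitz X sX lX by auto
      ultimately show "d ?p ?q \<le> 0 + \<epsilon>"
        using n triangle[of ?p ?r ?q] commute[of ?p ?r] pq by auto
    qed
    then have "d ?p ?q = 0" using nonneg[of ?p ?q] by linarith
    then show "?p = ?q" using pq by simp
  qed
  have close: "\<exists>N. \<forall>n\<ge>N. rho (s n) l \<le> ennreal \<epsilon>" if "0 < \<epsilon>" for \<epsilon>
  proof -
    obtain N where N: "\<forall>n m. N \<le> n \<longrightarrow> N \<le> m \<longrightarrow> D (s n) (s m) < \<epsilon> / 2" 
      using cau[of "\<epsilon> / 2"] \<open>0 < \<epsilon>\<close> by auto
    \<comment> \<open>\<open>N\<close> serves all coordinates at once; only the auxiliary index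
      \<open>m\<close> below depends on the coordinate.\<close>
    have "rho (s n) l \<le> ennreal \<epsilon>" if "n \<ge> N" for n
    proof (intro rho_least ennreal_leI)
      fix x y assume X: "x \<in> X" "y \<in> X"
      obtain M where M: "\<forall>m\<ge>M. d (s m (iv x y)) (l (iv x y)) < \<epsilon> / 2"
        using lim[OF X, of "\<epsilon> / 2"] \<open>0 < \<epsilon>\<close> by auto
      define m where "m = max N M"
      have m: "m \<ge> N" "m \<ge> M" by (auto simp: m_def)
      have "d (s m (iv x y)) (l (iv x y)) < \<epsilon> / 2" using M m by blast
      moreover have "d (s n (iv x y)) (s m (iv x y)) < \<epsilon> / 2"
        using coordinate_le_D[OF sC sC X, of n m] N[rule_format, OF \<open>n \<ge> N\<close> m(1)] by linarith
      ultimately show "d (s n (iv x y)) (l (iv x y)) \<le> \<epsilon>"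
        using triangle[OF sX(1)[OF X, of n] sX(1)[OF X, of m] lX[OF X]] by linarith
    qed
    then show ?thesis by blast
  qed
  have lC: "l \<in> C"
  proof -
    obtain N where "rho (s N) l \<le> ennreal 1" using close[of 1] by auto
    then show ?thesis using C_closed[OF sC lR, of N] by (simp add: le_less_trans)
  qed
  have "\<exists>N. \<forall>n\<ge>N. s n \<in> C \<and> D (s n) l < \<epsilon>" if pos: "0 < \<epsilon>" for \<epsilon>
  proof -
    obtain N where N: "\<forall>n\<ge>N. rho (s n) l \<le> ennreal (\<epsilon> / 2)" using close[of "\<epsilon> / 2"] pos by auto
    have "D (s n) l < \<epsilon>" if "n \<ge> N" for n
    proof -
      have "D (s n) l \<le> \<epsilon> / 2"
        using D_le_iff[OF sC lC, of "\<epsilon> / 2" n] N that \<open>0 < \<epsilon>\<close> by simp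
      then show ?thesis using \<open>0 < \<epsilon>\<close> by linarith
    qed
    then show ?thesis using sC by blast
  qed
  then show "\<exists>l. limitin C.mtopology s l sequentially"
    unfolding C.limit_metric_sequentially using lC by blast
qed

end


section \<open>Rank\<close>

lemma hypercube_cases: "a \<in> hypercube n \<Longrightarrow> i < n \<Longrightarrow> a i = 1 \<or> a i = -1"
  by (auto simp: hypercube_def PiE_iff)

lemma hypercube_eqI:
  assumes "a \<in> hypercube n" "b \<in> hypercube n" "\<And>i. i < n \<Longrightarrow> a i = b i"
  shows "a = b"
  using assms unfolding hypercube_def by (intro PiE_ext[where k = "{..<n}"]) auto

lemma finite_hypercube: "finite (hypercube n)"
  by (simp add: hypercube_def finite_PiE)

lemma constant_in_hypercube: "s \<in> {-1, 1} \<Longrightarrow> (\<lambda>i\<in>{..<n}. s) \<in> hypercube n"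
  by (auto simp: hypercube_def)

lemma hypercube_update: "a \<in> hypercube n \<Longrightarrow> i < n \<Longrightarrow> s \<in> {-1, 1} \<Longrightarrow> a(i := s) \<in> hypercube n"
  by (auto simp: hypercube_def PiE_iff extensional_def)

lemma hypercube_extend: "a \<in> hypercube n \<Longrightarrow> s \<in> {-1, 1} \<Longrightarrow> a(n := s) \<in> hypercube (Suc n)"
  by (auto simp: hypercube_def PiE_iff extensional_def less_Suc_eq)

lemma hypercube_restrict: "a \<in> hypercube (Suc n) \<Longrightarrow> restrict a {..<n} \<in> hypercube n"
  by (auto simp: hypercube_def PiE_iff)

lemma majority_apply: "i < n \<Longrightarrow> majority n a b c i = sgn (a i + b i + c i)"
  by (simp add: majority_def)

lemma majority_eq_1:
  assumes "a \<in> hypercube n" "b \<in> hypercube n" "c \<in> hypercube n" "i < n"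
  shows "majority n a b c i = 1 \<longleftrightarrow> (a i = 1 \<and> b i = 1 \<or> a i = 1 \<and> c i = 1 \<or> b i = 1 \<and> c i = 1)"
  using hypercube_cases[OF assms(1,4)] hypercube_cases[OF assms(2,4)] hypercube_cases[OF assms(3,4)] assms(4)
  by (auto simp: majority_apply)

lemma majority_in_hypercube:
  assumes "a \<in> hypercube n" "b \<in> hypercube n" "c \<in> hypercube n"
  shows "majority n a b c \<in> hypercube n"
proof -
  have "majority n a b c i \<in> {-1, 1}" if "i < n" for i
    using hypercube_cases[OF assms(1) that] hypercube_cases[OF assms(2) that]
      hypercube_cases[OF assms(3) that] that
    by (auto simp: majority_apply)
  then show ?thesis unfolding hypercube_def by (auto simp: PiE_iff majority_def)
qed

lemma majority_restrict:
  "restrict (majority (Suc n) a b c) {..<n} =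
     majority n (restrict a {..<n}) (restrict b {..<n}) (restrict c {..<n})"
  by (auto simp: majority_def fun_eq_iff)

section \<open>Cubes from halfspaces with nonempty orthants\<close>

context median_space
begin

text \<open>The third clause stands for membership in the convex hull of the points
  \<open>P\<close>; in the induction it keeps each face on its side of the new halfspace. The last
  clause expresses preservation of medians through halfspaces, which makes it accessible to
  propositional reasoning.\<close>

definition orthant_cube ::
    "nat \<Rightarrow> (nat \<Rightarrow> 'a set) \<Rightarrow> ((nat \<Rightarrow> int) \<Rightarrow> 'a) \<Rightarrow> ((nat \<Rightarrow> int) \<Rightarrow> 'a) \<Rightarrow> bool" where
  "orthant_cube n hs P g \<longleftrightarrow>
    (\<forall>v\<in>hypercube n. g v \<in> X) \<and> (\<forall>v\<in>hypercube n. \<forall>i<n. g v \<in> hs i \<longleftrightarrow> v i = 1) \<and>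
    (\<forall>h\<in>\<H>. (\<forall>v\<in>hypercube n. P v \<in> h) \<longrightarrow> (\<forall>v\<in>hypercube n. g v \<in> h)) \<and>
    (\<forall>h\<in>\<H>. \<forall>a\<in>hypercube n. \<forall>b\<in>hypercube n. \<forall>c\<in>hypercube n. g (majority n a b c) \<in> h \<longleftrightarrow>
      (g a \<in> h \<and> g b \<in> h \<or> g a \<in> h \<and> g c \<in> h \<or> g b \<in> h \<and> g c \<in> h))"

lemma orthant_cubeD:
  assumes "orthant_cube n hs P g"
  shows "v \<in> hypercube n \<Longrightarrow> g v \<in> X"
    and "v \<in> hypercube n \<Longrightarrow> i < n \<Longrightarrow> g v \<in> hs i \<longleftrightarrow> v i = 1"
    and "h \<in> \<H> \<Longrightarrow> (\<And>v. v \<in> hypercube n \<Longrightarrow> P v \<in> h) \<Longrightarrow> v \<in> hypercube n \<Longrightarrow> g v \<in> h"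
    and "h \<in> \<H> \<Longrightarrow> a \<in> hypercube n \<Longrightarrow> b \<in> hypercube n \<Longrightarrow> c \<in> hypercube n \<Longrightarrow>
      g (majority n a b c) \<in> h \<longleftrightarrow> (g a \<in> h \<and> g b \<in> h \<or> g a \<in> h \<and> g c \<in> h \<or> g b \<in> h \<and> g c \<in> h)"
  using assms unfolding orthant_cube_def by simp_all

text \<open>
  In the induction step the two opposite faces are made parallel by projecting the lower one to
  the interval spanned by the upper one, and the result back.
\<close>

lemma cube_in_orthants:
  assumes "\<And>i. i < n \<Longrightarrow> hs i \<in> \<H>"
    and "\<And>v. v \<in> hypercube n \<Longrightarrow> P v \<in> X"
    and "\<And>v i. v \<in> hypercube n \<Longrightarrow> i < n \<Longrightarrow> P v \<in> hs i \<longleftrightarrow> v i = 1"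
  shows "\<exists>g. orthant_cube n hs P g"
  using assms
proof (induction n arbitrary: P)
  case 0
  have "hypercube 0 = {\<lambda>_. undefined}" by (simp add: hypercube_def)
  moreover have "majority 0 a b c = (\<lambda>_. undefined)" for a b c by (auto simp: majority_def)
  ultimately show ?case using 0 by (intro exI[of _ P]) (auto simp: orthant_cube_def)
next
  case (Suc n)
  have hs: "hs i \<in> \<H>" if "i \<le> n" for i using Suc.prems(1) that by simp
  define Pm Pp where "Pm v = P (v(n := -1))" and "Pp v = P (v(n := 1))" for v
  have ext: "v(n := -1) \<in> hypercube (Suc n)" "v(n := 1) \<in> hypercube (Suc n)" if "v \<in> hypercube n" for v
    using hypercube_extend that by auto
  have Pm: "Pm v \<in> X" "i \<le> n \<Longrightarrow> Pm v \<in> hs i \<longleftrightarrow> (v(n := -1)) i = 1"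
    and Pp: "Pp v \<in> X" "i \<le> n \<Longrightarrow> Pp v \<in> hs i \<longleftrightarrow> (v(n := 1)) i = 1" if "v \<in> hypercube n" for v i
    using Suc.prems(2,3) ext that unfolding Pm_def Pp_def by (auto simp del: fun_upd_apply)
  have "\<exists>g. orthant_cube n hs Pm g"
    using hs Pm by (intro Suc.IH) auto
  then obtain gm where "orthant_cube n hs Pm gm" ..
  note gm = orthant_cubeD[OF this]
  have "\<exists>g. orthant_cube n hs Pp g"
    using hs Pp by (intro Suc.IH) auto
  then obtain gp where "orthant_cube n hs Pp gp" ..
  note gp = orthant_cubeD[OF this]
  define lo hi :: "nat \<Rightarrow> int" where "lo = (\<lambda>i\<in>{..<n}. -1)" and "hi = (\<lambda>i\<in>{..<n}. 1)"
  have lohi: "lo \<in> hypercube n" "hi \<in> hypercube n"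
    unfolding lo_def hi_def using constant_in_hypercube[of "-1" n] constant_in_hypercube[of 1 n] by auto
  have lohi_i: "lo i = -1" "hi i = 1" if "i < n" for i using that by (auto simp: lo_def hi_def)
  \<comment> \<open>Every vertex lies between the opposite vertices \<open>lo\<close> and
    \<open>hi\<close>, so \<open>gm v\<close> lies between \<open>gm lo\<close> and
    \<open>gm hi\<close>.\<close>
  have "majority n lo hi v = v" if "v \<in> hypercube n" for v
  proof (rule hypercube_eqI)
    show "majority n lo hi v i = v i" if "i < n" for i
      using hypercube_cases[OF \<open>v \<in> hypercube n\<close> that] that by (auto simp: majority_apply lohi_i)
  qed (use that majority_in_hypercube lohi in auto)
  then have bnd: "gm v \<in> h \<longleftrightarrow> (gm lo \<in> h \<and> gm hi \<in> h \<or> gm lo \<in> h \<and> gm v \<in> h \<or> gm hi \<in> h \<and> gm v \<in> h)"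
    if "h \<in> \<H>" "v \<in> hypercube n" for h v
    using gm(4)[OF that(1) lohi that(2)] that by simp
  define A B where "A v = med (gp lo) (gp hi) (gm v)" and "B v = med (gm lo) (gm hi) (A v)" for v
  have AX: "A v \<in> X" and BX: "B v \<in> X" if "v \<in> hypercube n" for v
    unfolding A_def B_def using med_iv gp gm lohi that by auto
  have Ah: "A v \<in> h \<longleftrightarrow> (gp lo \<in> h \<and> gp hi \<in> h \<or> gp lo \<in> h \<and> gm v \<in> h \<or> gp hi \<in> h \<and> gm v \<in> h)"
    if "h \<in> \<H>" "v \<in> hypercube n" for h v
    unfolding A_def using med_in_halfspace that gp gm lohi by auto
  have Bh: "B v \<in> h \<longleftrightarrow> (gm lo \<in> h \<and> gm hi \<in> h \<or> gm lo \<in> h \<and> A v \<in> h \<or> gm hi \<in> h \<and> A v \<in> h)"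
    if "h \<in> \<H>" "v \<in> hypercube n" for h v
    unfolding B_def using med_in_halfspace that AX gm lohi by auto
  define r where "r w = restrict w {..<n}" for w :: "nat \<Rightarrow> int"
  define G where "G w = (if w n = 1 then A (r w) else B (r w))" for w
  have r: "r w \<in> hypercube n" if "w \<in> hypercube (Suc n)" for w
    using hypercube_restrict that by (simp add: r_def)
  have r_i: "r w i = w i" if "i < n" for w i using that by (simp add: r_def)
  have gmn: "gm v \<notin> hs n" if "v \<in> hypercube n" for v
    using gm(3)[OF halfspace_Compl[OF hs[of n]] _ that] Pm by auto
  have gpn: "gp v \<in> hs n" if "v \<in> hypercube n" for v
    using gp(3)[OF hs[of n] _ that] Pp by auto
  \<comment> \<open>For \<open>i < n\<close> the images of \<open>lo\<close> and \<open>hi\<close>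
    lie on different sides of \<open>hs i\<close>, so both projections preserve membership. For
    \<open>i = n\<close> both ends of the target interval already lie on the required side.\<close>
  have orth: "G w \<in> hs i \<longleftrightarrow> w i = 1" if w: "w \<in> hypercube (Suc n)" and "i < Suc n" for w i
  proof (cases "i = n")
    case True
    then show ?thesis
      using Ah[OF hs[of n] r[OF w]] Bh[OF hs[of n] r[OF w]] gmn gpn lohi by (simp add: G_def)
  next
    case False
    then have i: "i < n" "i \<le> n" using that by auto
    show ?thesis
      using Ah[OF hs[OF i(2)] r[OF w]] Bh[OF hs[OF i(2)] r[OF w]]
        gm(2)[OF lohi(1) i(1)] gm(2)[OF lohi(2) i(1)] gm(2)[OF r[OF w] i(1)]
        gp(2)[OF lohi(1) i(1)] gp(2)[OF lohi(2) i(1)] lohi_i[OF i(1)] r_i[OF i(1)]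
      by (simp add: G_def)
  qed
  have inv: "G w \<in> h" if h: "h \<in> \<H>" and P: "\<forall>v\<in>hypercube (Suc n). P v \<in> h" and w: "w \<in> hypercube (Suc n)" for h w
  proof -
    have "gm v \<in> h" "gp v \<in> h" if "v \<in> hypercube n" for v
      using gm(3)[OF h _ that] gp(3)[OF h _ that] P ext unfolding Pm_def Pp_def by auto
    then show ?thesis using Ah[OF h r[OF w]] Bh[OF h r[OF w]] lohi by (simp add: G_def)
  qed
  have hom: "G (majority (Suc n) a b c) \<in> h \<longleftrightarrow> (G a \<in> h \<and> G b \<in> h \<or> G a \<in> h \<and> G c \<in> h \<or> G b \<in> h \<and> G c \<in> h)"
    if h: "h \<in> \<H>" and abc: "a \<in> hypercube (Suc n)" "b \<in> hypercube (Suc n)" "c \<in> hypercube (Suc n)" for h a b c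
  proof -
    note ra = r[OF abc(1)] and rb = r[OF abc(2)] and rc = r[OF abc(3)]
    let ?m = "majority (Suc n) a b c"
    have rm: "r ?m = majority n (r a) (r b) (r c)" unfolding r_def by (rule majority_restrict)
    have rm': "r ?m \<in> hypercube n" unfolding rm using majority_in_hypercube ra rb rc .
    have mn: "?m n = 1 \<longleftrightarrow> (a n = 1 \<and> b n = 1 \<or> a n = 1 \<and> c n = 1 \<or> b n = 1 \<and> c n = 1)"
      using majority_eq_1[OF abc] by simp
    have Gw: "G w \<in> h \<longleftrightarrow> (w n = 1 \<and> A (r w) \<in> h \<or> w n \<noteq> 1 \<and> B (r w) \<in> h)" for w by (simp add: G_def)
    \<comment> \<open>If \<open>h\<close> separates \<open>gm lo\<close> from \<open>gm hi\<close>
      and \<open>gp lo\<close> from \<open>gp hi\<close>, then \<open>A v\<close> and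
      \<open>B v\<close> lie on the side of \<open>gm v\<close>. Otherwise neither
      \<open>A v\<close> nor \<open>B v\<close> changes sides as \<open>v\<close> varies. In both
      cases majorities that mix the two faces are respected.\<close>
    show ?thesis
      unfolding Gw mn Bh[OF h ra] Bh[OF h rb] Bh[OF h rc] Bh[OF h rm']
        Ah[OF h ra] Ah[OF h rb] Ah[OF h rc] Ah[OF h rm'] gm(4)[OF h ra rb rc, folded rm]
      using bnd[OF h ra] bnd[OF h rb] bnd[OF h rc] by argo
  qed
  show ?case
    using AX BX r orth inv hom unfolding orthant_cube_def
    by (intro exI[of _ G] conjI ballI allI impI) (simp_all add: G_def)
qed

text \<open>Vertices that differ in coordinate \<open>i\<close> are separated by
  \<open>hs i\<close>, which gives injectivity. Rank is thus bounded below by exhibiting halfspaces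
  and one point per orthant.\<close>

lemma hypercube_embeds_orthants:
  assumes hs: "\<And>i. i < n \<Longrightarrow> hs i \<in> \<H>"
    and "\<And>v. v \<in> hypercube n \<Longrightarrow> P v \<in> X"
    and "\<And>v i. v \<in> hypercube n \<Longrightarrow> i < n \<Longrightarrow> P v \<in> hs i \<longleftrightarrow> v i = 1"
  shows "hypercube_embeds X d n"
proof -
  obtain g where "orthant_cube n hs P g" using cube_in_orthants[of n hs P] assms by blast
  note g = orthant_cubeD[OF this]
  have "inj_on g (hypercube n)"
  proof (rule inj_onI)
    fix a b assume ab: "a \<in> hypercube n" "b \<in> hypercube n" "g a = g b"
    show "a = b"
    proof (rule hypercube_eqI[OF ab(1,2)])
      fix i assume "i < n"
      then show "a i = b i"
        using g(2)[OF ab(1), of i] g(2)[OF ab(2), of i] ab(3) hypercube_cases[OF ab(1), of i]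
          hypercube_cases[OF ab(2), of i] by auto
    qed
  qed
  moreover have "g (majority n a b c) = med (g a) (g b) (g c)"
    if "a \<in> hypercube n" "b \<in> hypercube n" "c \<in> hypercube n" for a b c
    using that g med_iv majority_in_hypercube
    by (intro eq_by_halfspaces) (auto simp: med_in_halfspace)
  ultimately show ?thesis
    unfolding hypercube_embeds_def using g(1) by blast
qed

text \<open>This is density of \<open>X\<close> in the compactification. A point \<open>z\<close>
  that is right for \<open>F\<close> and a point \<open>w\<close> on the right side of
  \<open>h\<close> combine to \<open>m(z, w, \<xi>)\<close>, which by majority is right for all of
  them.\<close>

lemma approximate_roller_point:
  assumes xi: "\<xi> \<in> \<R>" and F: "finite F" "F \<subseteq> \<H>" and ne: "X \<noteq> {}"
  shows "\<exists>z\<in>X. \<forall>h\<in>F. z \<in> h \<longleftrightarrow> h \<in> uf \<xi>"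
  using F
proof (induction F rule: finite_induct)
  case empty
  then show ?case using ne by auto
next
  case (insert h F)
  then obtain z where z: "z \<in> X" "\<forall>k\<in>F. z \<in> k \<longleftrightarrow> k \<in> uf \<xi>" by auto
  have h: "h \<in> \<H>" using insert by simp
  obtain x y where "x \<in> X" "y \<in> X" "x \<notin> h" "y \<in> h" using h by (rule halfspace_crossed)
  then obtain w where w: "w \<in> X" "w \<in> h \<longleftrightarrow> h \<in> uf \<xi>" by metis
  have "\<xi> (iv z w) \<in> k \<longleftrightarrow> k \<in> uf \<xi>" if "k \<in> insert h F" for k
  proof -
    have "k \<in> \<H>" using that insert by auto
    then show ?thesis using ev_in_halfspace[OF xi _ z(1) w(1), of k] that z w by auto
  qed
  then show ?case using roller_ev(2)[OF xi z(1) w(1)] by blast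
qed

end

section \<open>Cubes in a component and the strict drop of rank\<close>

context roller_component
begin

text \<open>Choose an interval in which the coordinates of \<open>p\<^sub>0\<close> and
  \<open>\<xi>\<^sub>0\<close> are farther apart than \<open>M\<close>. If every halfspace between
  these coordinates failed, each would separate \<open>p\<^sub>0\<close> from a point of
  \<open>P\<close> or \<open>\<xi>\<^sub>0\<close> from a point of \<open>S\<close>, and finite
  subadditivity would bound the distance by \<open>M\<close>.\<close>

lemma halfspace_towards_component:
  assumes inf: "\<And>p. p \<in> X \<Longrightarrow> rho (emb p) \<xi>\<^sub>0 = top"
    and P: "finite P" "P \<subseteq> X" and S: "finite S" "S \<subseteq> C"
  shows "\<exists>h\<in>\<H>. (\<forall>\<xi>\<in>S. h \<in> uf \<xi>) \<and> (\<forall>p\<in>P. p \<notin> h)"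
proof -
  obtain p\<^sub>0 where p0: "p\<^sub>0 \<in> X" using X_nonempty by auto
  define M where "M = (\<Sum>p\<in>P. d p\<^sub>0 p) + (\<Sum>\<xi>\<in>S. D \<xi> \<xi>\<^sub>0)"
  have "ennreal M < rho (emb p\<^sub>0) \<xi>\<^sub>0" using inf[OF p0] by simp
  then obtain x y where xy: "x \<in> X" "y \<in> X"
    and "ennreal M < ennreal (d (emb p\<^sub>0 (iv x y)) (\<xi>\<^sub>0 (iv x y)))"
    unfolding rho_def less_SUP_iff by auto
  then have less: "M < d (emb p\<^sub>0 (iv x y)) (\<xi>\<^sub>0 (iv x y))"
    by (meson ennreal_leI linorder_not_le)
  let ?a = "emb p\<^sub>0 (iv x y)" and ?b = "\<xi>\<^sub>0 (iv x y)"
  have ab: "?a \<in> X" "?b \<in> X" using roller_ev(2) xy emb_in_roller p0 base_in_roller by auto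
  have ex: "\<exists>h\<in>HI ?a ?b. (\<forall>\<xi>\<in>S. h \<in> uf \<xi>) \<and> (\<forall>p\<in>P. p \<notin> h)"
  proof (rule ccontr)
    assume none: "\<not> ?thesis"
    \<comment> \<open>\<open>Inl p\<close> stands for \<open>HI p\<^sub>0 p\<close>, and
      \<open>Inr \<xi>\<close> for the halfspaces between the coordinates of \<open>\<xi>\<close>
      and \<open>\<xi>\<^sub>0\<close> in \<open>iv x y\<close>.\<close>
    define u v where "u = case_sum (\<lambda>p :: 'a. p\<^sub>0) (\<lambda>\<xi>. \<xi> (iv x y))" and "v = case_sum (\<lambda>p. p) (\<lambda>\<xi> :: 'a set \<Rightarrow> 'a. ?b)"
    have "d ?a ?b \<le> (\<Sum>i\<in>P <+> S. d (u i) (v i))"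
    proof (rule finite_subadditive)
      show "finite (P <+> S)" using P S by simp
      show "u i \<in> X \<and> v i \<in> X" if "i \<in> P <+> S" for i
        using that P S p0 ab roller_ev(2) xy C_roller by (auto simp: u_def v_def)
      show "HI ?a ?b \<subseteq> (\<Union>i\<in>P <+> S. HI (u i) (v i))"
      proof
        fix h assume h: "h \<in> HI ?a ?b"
        then have hd: "h \<in> ufdiff (emb p\<^sub>0) \<xi>\<^sub>0"
          using HI_ev_sub_ufdiff[OF emb_in_roller[OF p0] base_in_roller xy] by blast
        then have hH: "h \<in> \<H>" "p\<^sub>0 \<notin> h" "h \<in> uf \<xi>\<^sub>0" using uf_emb[OF p0] by (auto simp: ufdiff_def)
        consider p where "p \<in> P" "p \<in> h" | \<xi> where "\<xi> \<in> S" "h \<notin> uf \<xi>" using none h by blast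
        then show "h \<in> (\<Union>i\<in>P <+> S. HI (u i) (v i))"
        proof cases
          case 1
          then show ?thesis using hH by (intro UN_I[of "Inl p"]) (auto simp: HI_iff u_def v_def)
        next
          case 2
          have "\<not> (x \<in> h \<and> y \<in> h)"
            using h ev_in_halfspace[OF emb_in_roller[OF p0] hH(1) xy] by (auto simp: HI_iff)
          then have "\<xi> (iv x y) \<notin> h"
            using 2 S C_roller ev_in_halfspace[OF _ hH(1) xy, of \<xi>] by auto
          then show ?thesis using 2 h by (intro UN_I[of "Inr \<xi>"]) (auto simp: HI_iff u_def v_def)
        qed
      qed
    qed (use ab in auto)
    also have "\<dots> = (\<Sum>p\<in>P. d p\<^sub>0 p) + (\<Sum>\<xi>\<in>S. d (\<xi> (iv x y)) ?b)"
      using P S by (simp add: sum.Plus u_def v_def)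
    also have "\<dots> \<le> M"
      unfolding M_def using S base_in_C xy by (intro add_left_mono sum_mono coordinate_le_D) auto
    finally show False using less by simp
  qed
  then show ?thesis by (auto simp: HI_iff)
qed

lemma uf_median_hom:
  assumes f: "f \<in> hypercube k \<rightarrow> C"
    and hom: "\<And>a b c. \<lbrakk>a \<in> hypercube k; b \<in> hypercube k; c \<in> hypercube k\<rbrakk> \<Longrightarrow>
      f (majority k a b c) = median C D (f a) (f b) (f c)"
    and abc: "a \<in> hypercube k" "b \<in> hypercube k" "c \<in> hypercube k" and h: "h \<in> \<H>"
  shows "h \<in> uf (f (majority k a b c)) \<longleftrightarrow>
    (h \<in> uf (f a) \<and> h \<in> uf (f b) \<or> h \<in> uf (f a) \<and> h \<in> uf (f c) \<or> h \<in> uf (f b) \<and> h \<in> uf (f c))"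
proof -
  have C: "f a \<in> C" "f b \<in> C" "f c \<in> C" using f abc by auto
  have "f (majority k a b c) = rmed (f a) (f b) (f c)"
    using hom[OF abc] median_component_eq[OF C] by simp
  then show ?thesis using uf_rmed[OF C[THEN C_roller] h] by simp
qed

text \<open>Some halfspace separates the images of the all-ones vertex \<open>e\<close> and of
  \<open>e'\<close>, which differs from it only at \<open>i\<close>; passing to the complement fixes
  the orientation. The majority of \<open>e\<close>, \<open>e'\<close> and \<open>a\<close> is
  \<open>e\<close> or \<open>e'\<close> according to \<open>a i\<close>, so this halfspace reads off
  the coordinate at every vertex.\<close>

lemma hypercube_coordinate_halfspace:
  assumes f: "f \<in> hypercube k \<rightarrow> C" and inj: "inj_on f (hypercube k)"
    and hom: "\<And>a b c. \<lbrakk>a \<in> hypercube k; b \<in> hypercube k; c \<in> hypercube k\<rbrakk> \<Longrightarrow>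
      f (majority k a b c) = median C D (f a) (f b) (f c)"
    and i: "i < k"
  shows "\<exists>h\<in>\<H>. \<forall>a\<in>hypercube k. h \<in> uf (f a) \<longleftrightarrow> a i = 1"
proof -
  define e e' where "e = (\<lambda>j\<in>{..<k}. 1::int)" and "e' = e(i := -1)"
  have e: "e \<in> hypercube k" unfolding e_def using constant_in_hypercube[of 1 k] by simp
  have e': "e' \<in> hypercube k" unfolding e'_def using hypercube_update[OF e i] by simp
  have R: "f e \<in> \<R>" "f e' \<in> \<R>" using f e e' C_roller by auto
  have "e i \<noteq> e' i" using i by (simp add: e_def e'_def)
  then have "f e \<noteq> f e'" using inj e e' by (auto dest: inj_onD)
  then obtain k\<^sub>0 where "k\<^sub>0 \<in> \<H>" "(k\<^sub>0 \<in> uf (f e)) \<noteq> (k\<^sub>0 \<in> uf (f e'))" using roller_eqI[OF R] by blast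
  then obtain h where h: "h \<in> \<H>" "h \<in> uf (f e)" "h \<notin> uf (f e')"
    using halfspace_Compl uf_Compl R by metis
  have "h \<in> uf (f a) \<longleftrightarrow> a i = 1" if a: "a \<in> hypercube k" for a
  proof -
    have "majority k e e' a = (if a i = 1 then e else e')"
    proof (rule hypercube_eqI)
      show "majority k e e' a j = (if a i = 1 then e else e') j" if "j < k" for j
        using hypercube_cases[OF a that] that by (auto simp: majority_apply e_def e'_def)
    qed (use majority_in_hypercube[OF e e' a] e e' in auto)
    moreover have "h \<in> uf (f (majority k e e' a)) \<longleftrightarrow> h \<in> uf (f a)"
      by (subst uf_median_hom[OF f]) (use hom e e' a h in auto)
    ultimately show ?thesis using h(2,3) by (cases "a i = 1") simp_all
  qed
  then show ?thesis using h(1) by blast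
qed

lemma hypercube_embeds_Suc:
  assumes inf: "\<And>p. p \<in> X \<Longrightarrow> rho (emb p) \<xi>\<^sub>0 = top" and emb: "hypercube_embeds C D k"
  shows "hypercube_embeds X d (Suc k)"
proof -
  obtain f where f: "f \<in> hypercube k \<rightarrow> C" and inj: "inj_on f (hypercube k)"
    and hom: "\<And>a b c. \<lbrakk>a \<in> hypercube k; b \<in> hypercube k; c \<in> hypercube k\<rbrakk> \<Longrightarrow>
      f (majority k a b c) = median C D (f a) (f b) (f c)"
    using emb unfolding hypercube_embeds_def by blast
  have "\<exists>h. h \<in> \<H> \<and> (\<forall>a\<in>hypercube k. h \<in> uf (f a) \<longleftrightarrow> a i = 1)" if "i < k" for i
    using hypercube_coordinate_halfspace[OF f inj hom that] by blast
  then obtain hs where hs: "\<And>i. i < k \<Longrightarrow> hs i \<in> \<H>"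
    "\<And>i a. i < k \<Longrightarrow> a \<in> hypercube k \<Longrightarrow> hs i \<in> uf (f a) \<longleftrightarrow> a i = 1" by metis
  have R: "f a \<in> \<R>" if "a \<in> hypercube k" for a using f that C_roller by auto
  have "\<exists>z\<in>X. \<forall>h\<in>hs ` {..<k}. z \<in> h \<longleftrightarrow> h \<in> uf (f a)" if "a \<in> hypercube k" for a
    using hs by (intro approximate_roller_point R that X_nonempty) auto
  then have "\<exists>z. z \<in> X \<and> (\<forall>i<k. z \<in> hs i \<longleftrightarrow> a i = 1)" if "a \<in> hypercube k" for a
    using hs(2)[OF _ that] that by fastforce
  then obtain p where p: "\<And>a. a \<in> hypercube k \<Longrightarrow> p a \<in> X"
    "\<And>a i. a \<in> hypercube k \<Longrightarrow> i < k \<Longrightarrow> p a \<in> hs i \<longleftrightarrow> a i = 1" by metis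
  \<comment> \<open>The additional halfspace has all points \<open>p a\<close> on one side and all
    vertices \<open>f a\<close> on the other.\<close>
  have "\<exists>h\<in>\<H>. (\<forall>\<xi>\<in>f ` hypercube k. h \<in> uf \<xi>) \<and> (\<forall>z\<in>p ` hypercube k. z \<notin> h)"
    using finite_hypercube p f by (intro halfspace_towards_component[OF inf]) auto
  then obtain h where h: "h \<in> \<H>" "\<forall>\<xi>\<in>f ` hypercube k. h \<in> uf \<xi>" "\<forall>z\<in>p ` hypercube k. z \<notin> h"
    by blast
  \<comment> \<open>Approximating \<open>f a\<close> again, now with respect to \<open>h\<close> as
    well, gives points in the same orthants as the \<open>p a\<close> but inside
    \<open>h\<close>.\<close>
  have "\<exists>z\<in>X. \<forall>h\<in>insert h (hs ` {..<k}). z \<in> h \<longleftrightarrow> h \<in> uf (f a)" if "a \<in> hypercube k" for a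
    using hs h by (intro approximate_roller_point R that X_nonempty) auto
  then have "\<exists>z. z \<in> X \<and> z \<in> h \<and> (\<forall>i<k. z \<in> hs i \<longleftrightarrow> a i = 1)" if "a \<in> hypercube k" for a
    using hs(2)[OF _ that] h(2) that by fastforce
  then obtain q where q: "\<And>a. a \<in> hypercube k \<Longrightarrow> q a \<in> X" "\<And>a. a \<in> hypercube k \<Longrightarrow> q a \<in> h"
    "\<And>a i. a \<in> hypercube k \<Longrightarrow> i < k \<Longrightarrow> q a \<in> hs i \<longleftrightarrow> a i = 1" by metis
  show ?thesis
  proof (rule hypercube_embeds_orthants)
    let ?r = "\<lambda>v :: nat \<Rightarrow> int. restrict v {..<k}"
    let ?P = "\<lambda>v. if v k = 1 then q (?r v) else p (?r v)"
    show "(hs(k := h)) i \<in> \<H>" if "i < Suc k" for i using that hs h by auto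
    fix v assume "v \<in> hypercube (Suc k)"
    then have rv: "?r v \<in> hypercube k" by (rule hypercube_restrict)
    show "?P v \<in> X" using p q rv by auto
    show "?P v \<in> (hs(k := h)) i \<longleftrightarrow> v i = 1" if "i < Suc k" for i
      using that p q rv h(3) by (cases "i = k") auto
  qed
qed

lemma median_rank_component_less:
  assumes inf: "\<And>p. p \<in> X \<Longrightarrow> rho (emb p) \<xi>\<^sub>0 = top" and fin: "median_rank X d < \<infinity>"
  shows "median_rank C D < median_rank X d"
proof -
  have le: "enat (Suc k) \<le> median_rank X d" if "hypercube_embeds C D k" for k
    unfolding median_rank_def using hypercube_embeds_Suc[OF inf that] by (intro SUP_upper) auto
  obtain n where n: "median_rank X d = enat n" using fin by auto
  \<comment> \<open>The cube of dimension zero embeds in \<open>C\<close>, which gives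
    \<open>1 \<le> n\<close>, so the subtraction \<open>n - 1\<close> below is not
    truncated.\<close>
  have "hypercube 0 = {\<lambda>_. undefined}" by (simp add: hypercube_def)
  moreover have "median C D \<xi>\<^sub>0 \<xi>\<^sub>0 \<xi>\<^sub>0 = \<xi>\<^sub>0"
  proof -
    have "rmed \<xi>\<^sub>0 \<xi>\<^sub>0 \<xi>\<^sub>0 = \<xi>\<^sub>0"
      using uf_rmed base_in_roller rmed_in_roller by (intro roller_eqI) auto
    then show ?thesis using median_component_eq base_in_C by simp
  qed
  ultimately have "hypercube_embeds C D 0"
    unfolding hypercube_embeds_def using base_in_C by (intro exI[of _ "\<lambda>_. \<xi>\<^sub>0"]) auto
  then have "1 \<le> n" using le[of 0] n by (simp add: one_enat_def)
  have "k \<le> n - 1" if "hypercube_embeds C D k" for k using le[OF that] n by simp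
  then have "median_rank C D \<le> enat (n - 1)"
    unfolding median_rank_def by (intro SUP_least) simp
  also have "\<dots> < enat n" using \<open>1 \<le> n\<close> by simp
  finally show ?thesis using n by simp
qed

end

theorem theorem4:
  fixes X :: "'a set" and d :: "'a \<Rightarrow> 'a \<Rightarrow> real" and C :: "('a set \<Rightarrow> 'a) set"
  assumes "X \<noteq> {}"
    and "median_space X d"
    and "Metric_space.mcomplete X d"
    and "median_rank X d < \<infinity>"
    and "C \<in> boundary_components X d"
  shows "median_space C (component_dist X d)
    \<and> Metric_space.mcomplete C (component_dist X d)
    \<and> median_rank C (component_dist X d) < median_rank X d"
proof -
  interpret median_space X d by fact
  obtain \<xi>\<^sub>0 where xi: "\<xi>\<^sub>0 \<in> \<R>" and C: "C = {\<eta> \<in> \<R>. roller_dist X d \<xi>\<^sub>0 \<eta> < top}"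
    and not_X: "C \<noteq> emb ` X"
    using assms(5) unfolding boundary_components_def roller_components_def
    by (auto elim!: quotientE)
  have C': "C = {\<eta> \<in> \<R>. rho \<xi>\<^sub>0 \<eta> < top}"
    unfolding C using roller_dist_eq_rho[OF xi _ assms(1)] by auto
  interpret roller_component X d C \<xi>\<^sub>0
    by unfold_locales (use assms(1) xi C' in auto)
  \<comment> \<open>A single point of \<open>X\<close> at finite distance would make
    \<open>C\<close> the component of \<open>X\<close>, which is not a boundary component.\<close>
  have "rho (emb p) \<xi>\<^sub>0 = top" if p: "p \<in> X" for p
  proof (rule ccontr)
    assume "rho (emb p) \<xi>\<^sub>0 \<noteq> top"
    then have fin: "rho (emb p) \<xi>\<^sub>0 < top" by (simp add: less_top)
    have pC: "emb p \<in> C" using fin emb_in_roller[OF p] by (simp add: C' rho_commute)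
    have "C = emb ` X"
    proof (intro subset_antisym subsetI)
      fix \<eta> assume "\<eta> \<in> C"
      then show "\<eta> \<in> emb ` X"
        using finite_distance_in_space[OF assms(3) _ p] rho_finite[OF pC] C_roller by blast
    next
      fix \<eta> assume "\<eta> \<in> emb ` X"
      then obtain x where x: "x \<in> X" "\<eta> = emb x" by auto
      then show "\<eta> \<in> C" using C_closed[OF pC emb_in_roller[OF x(1)]] rho_emb[OF p x(1)] by simp
    qed
    then show False using not_X by simp
  qed
  then show ?thesis
    using median_space_component mcomplete_component[OF assms(3)] median_rank_component_less assms(4)
    by blast
qed

end
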